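(* There exists a continuous linear operator $T:\ell_1\to\ell_1$ that is multiply recurrent and hypercyclic but not weakly mixing.
   Context: $T$ is hypercyclic if some vector has a dense orbit under $T$. $T$ is weakly mixing if $T\oplus T$ is hypercyclic on $\ell_1\oplus\ell_1$. $T$ is multiply recurrent if for every nonempty open set $U$ and every $m\in\mathbb{N}$ there is $k\ge 1$ such that $U\cap T^{-k}(U)\cap\dots\cap T^{-km}(U)\neq\emptyset$. *)

theory Defs
  imports "HOL-Analysis.Analysis"
begin

typedef (overloaded) 'a ell1 =
  "{x :: nat \<Rightarrow> 'a::real_normed_vector. summable (\<lambda>n. norm (x n))}"
  morphisms coord Abs_ell1
  by (rule exI[of _ "\<lambda>_. 0"]) simp

setup_lifting type_definition_ell1

lemma ell1_eqI: "(\<And>n. coord x n = coord y n) \<Longrightarrow> x = y"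
  by (simp add: coord_inject[symmetric] fun_eq_iff)

lemma summable_norm_coord: "summable (\<lambda>n. norm (coord x n))"
  using coord[of x] by simp

lemma summable_norm_add:
  fixes x y :: "nat \<Rightarrow> 'a::real_normed_vector"
  assumes "summable (\<lambda>n. norm (x n))" "summable (\<lambda>n. norm (y n))"
  shows "summable (\<lambda>n. norm (x n + y n))"
  by (rule summable_comparison_test'[OF summable_add[OF assms], of 0])
    (simp add: norm_triangle_ineq)

lemma summable_norm_diff:
  fixes x y :: "nat \<Rightarrow> 'a::real_normed_vector"
  assumes "summable (\<lambda>n. norm (x n))" "summable (\<lambda>n. norm (y n))"
  shows "summable (\<lambda>n. norm (x n - y n))"
  by (rule summable_comparison_test'[OF summable_add[OF assms], of 0])
    (simp add: norm_triangle_ineq4)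

instantiation ell1 :: (real_normed_vector) real_normed_vector
begin

lift_definition zero_ell1 :: "'a ell1" is "\<lambda>_. 0"
  by simp

lift_definition plus_ell1 :: "'a ell1 \<Rightarrow> 'a ell1 \<Rightarrow> 'a ell1" is "\<lambda>x y n. x n + y n"
  by (rule summable_norm_add)

lift_definition minus_ell1 :: "'a ell1 \<Rightarrow> 'a ell1 \<Rightarrow> 'a ell1" is "\<lambda>x y n. x n - y n"
  by (rule summable_norm_diff)

lift_definition uminus_ell1 :: "'a ell1 \<Rightarrow> 'a ell1" is "\<lambda>x n. - x n"
  by simp

lift_definition scaleR_ell1 :: "real \<Rightarrow> 'a ell1 \<Rightarrow> 'a ell1" is "\<lambda>r x n. r *\<^sub>R x n"
  by (simp add: summable_mult)

lift_definition norm_ell1 :: "'a ell1 \<Rightarrow> real" is "\<lambda>x. \<Sum>n. norm (x n)" .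

definition sgn_ell1 :: "'a ell1 \<Rightarrow> 'a ell1"
  where "sgn_ell1 x = inverse (norm x) *\<^sub>R x"

definition dist_ell1 :: "'a ell1 \<Rightarrow> 'a ell1 \<Rightarrow> real"
  where "dist_ell1 x y = norm (x - y)"

definition uniformity_ell1 :: "('a ell1 \<times> 'a ell1) filter"
  where "uniformity_ell1 = (INF e\<in>{0<..}. principal {(x, y). dist x y < e})"

definition open_ell1 :: "'a ell1 set \<Rightarrow> bool"
  where "open_ell1 U = (\<forall>x\<in>U. \<forall>\<^sub>F (x', y) in uniformity. x' = x \<longrightarrow> y \<in> U)"

instance
proof
  fix x y z :: "'a ell1" and a b :: real
  show "x + y + z = x + (y + z)" "x + y = y + x" "0 + x = x" "- x + x = 0" "x - y = x + - y"
    by (transfer; simp add: algebra_simps)+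
  show "a *\<^sub>R (x + y) = a *\<^sub>R x + a *\<^sub>R y" "(a + b) *\<^sub>R x = a *\<^sub>R x + b *\<^sub>R x"
    "a *\<^sub>R b *\<^sub>R x = (a * b) *\<^sub>R x" "1 *\<^sub>R x = x"
    by (transfer; simp add: algebra_simps)+
  show "dist x y = norm (x - y)" "sgn x = inverse (norm x) *\<^sub>R x"
    by (simp_all add: dist_ell1_def sgn_ell1_def)
  show "uniformity = (INF e\<in>{0<..}. principal {(x, y :: 'a ell1). dist x y < e})"
    by (fact uniformity_ell1_def)
  show "open U = (\<forall>x\<in>U. \<forall>\<^sub>F (x', y) in uniformity. x' = x \<longrightarrow> y \<in> U)" for U :: "'a ell1 set"
    by (fact open_ell1_def)
  show "norm x = 0 \<longleftrightarrow> x = 0"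
    by transfer (simp add: suminf_eq_zero_iff fun_eq_iff)
  show "norm (x + y) \<le> norm x + norm y"
  proof transfer
    fix x y :: "nat \<Rightarrow> 'a"
    assume x: "summable (\<lambda>n. norm (x n))" and y: "summable (\<lambda>n. norm (y n))"
    have "summable (\<lambda>n. norm (x n + y n))"
      by (rule summable_norm_add[OF x y])
    then show "(\<Sum>n. norm (x n + y n)) \<le> (\<Sum>n. norm (x n)) + (\<Sum>n. norm (y n))"
      unfolding suminf_add[OF x y]
      by (intro suminf_le norm_triangle_ineq summable_add x y)
  qed
  show "norm (a *\<^sub>R x) = \<bar>a\<bar> * norm x"
    by transfer (simp add: suminf_mult)
qed

end

lift_definition ell1_scale :: "'a::real_normed_field \<Rightarrow> 'a ell1 \<Rightarrow> 'a ell1"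
  is "\<lambda>c x n. c * x n"
  by (simp add: norm_mult summable_mult)

lemma vector_space_ell1_scale: "vector_space ell1_scale"
  by unfold_locales (transfer; simp add: algebra_simps)+

definition hypercyclic :: "('a::topological_space \<Rightarrow> 'a) \<Rightarrow> bool"
  where "hypercyclic T \<longleftrightarrow> (\<exists>x. closure (range (\<lambda>n. (T ^^ n) x)) = UNIV)"

definition weakly_mixing :: "('a::topological_space \<Rightarrow> 'a) \<Rightarrow> bool"
  where "weakly_mixing T \<longleftrightarrow> hypercyclic (map_prod T T)"

definition multiply_recurrent :: "('a::topological_space \<Rightarrow> 'a) \<Rightarrow> bool"
  where "multiply_recurrent T \<longleftrightarrow>
    (\<forall>U m. open U \<and> U \<noteq> {} \<longrightarrow>
      (\<exists>k\<ge>1. U \<inter> (\<Inter>j\<in>{1..m}. (T ^^ (k * j)) -` U) \<noteq> {}))"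

end

theory Submission
  imports Defs "HOL-Computational_Algebra.Polynomial"
begin

text \<open>
  Let \<open>K\<close> be the scalar field. The operator is multiplication by \<open>z\<close> on a completion of the
  polynomial algebra \<open>K[z]\<close>. Choose polynomials \<open>q\<^sub>i = z\<^sup>i - R\<^sub>i\<close> with \<open>deg R\<^sub>i < i\<close> and weights
  \<open>c\<^sub>i > 0\<close>, and give \<open>K[z]\<close> the norm in which the basis \<open>c\<^sub>i q\<^sub>i\<close> becomes the unit vector basis of
  \<open>\<ell>\<^sub>1\<close>. In this picture the orbit of the vector \<open>1\<close> consists of the monomials, and

  \<^item> multiplication is continuous if the vectors \<open>z c\<^sub>i q\<^sub>i\<close> are bounded;
  \<^item> \<open>1\<close> is hypercyclic if the monomials come close to every polynomial;
  \<^item> multiplication is multiply recurrent if for all \<open>m\<close> there are \<open>k\<close> such that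
    \<open>z\<^sup>k, z\<^sup>2\<^sup>k, \<dots>, z\<^sup>m\<^sup>k\<close> are all close to \<open>1\<close>, because multiplication by a fixed polynomial is
    continuous and so turns this into the same property of that polynomial.

  Weak mixing is excluded by a linear functional \<open>\<phi>\<close> on \<open>K[z]\<close> with \<open>\<phi>(1) = 1\<close> such that the
  bilinear form \<open>(p, p') \<mapsto> \<phi>(p p')\<close> is bounded. On \<open>\<ell>\<^sub>1\<close> this only means that the numbers
  \<open>c\<^sub>i c\<^sub>k \<phi>(q\<^sub>i q\<^sub>k)\<close> are bounded. If \<open>T \<oplus> T\<close> had a dense orbit, there would be \<open>p, p'\<close> and \<open>k\<close>
  with \<open>p \<approx> 0\<close>, \<open>z\<^sup>k p \<approx> 1\<close>, \<open>p' \<approx> 1\<close> and \<open>z\<^sup>k p' \<approx> 0\<close>; then \<open>\<phi>(z\<^sup>k p p')\<close> is close to \<open>1\<close> when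
  read as \<open>\<phi>((z\<^sup>k p) p')\<close> and close to \<open>0\<close> when read as \<open>\<phi>(p (z\<^sup>k p'))\<close>.

  The data are built in stages. Let \<open>P\<^sub>0, P\<^sub>1, \<dots>\<close> run through a dense set of polynomials that contains
  \<open>1\<close>, each one infinitely often. Stage \<open>n\<close> uses an exponent \<open>b\<close>, the period, which is far larger than
  everything seen before, and arranges that \<open>z\<^sup>j\<^sup>b \<approx> P\<^sub>n\<^sup>j\<close> for \<open>1 \<le> j \<le> n + 1\<close>: for \<open>s\<close> in a short
  window the basis polynomial of degree \<open>j b + s\<close> is \<open>z\<^sup>s (z\<^sup>j\<^sup>b - P\<^sub>n\<^sup>j)\<close>, with weight \<open>2\<^sup>n\<close> at \<open>s = 0\<close>.
  The case \<open>j = 1\<close> gives hypercyclicity, and the stages with \<open>P\<^sub>n = 1\<close> give multiple recurrence.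
  All other basis polynomials are monomials, so \<open>z\<^sup>b\<close> itself must be entered from the monomial
  \<open>z\<^sup>b\<^sup>-\<^sup>1\<close>. The weights of the monomials therefore fall to a tiny value \<open>2\<^sup>-\<^sup>h\<close> before \<open>b\<close>, and inside
  a window they fall from \<open>2\<^sup>n\<close> to \<open>2\<^sup>-\<^sup>h\<close>; they fall by a factor of at most 2 per step, which
  keeps multiplication continuous (\<open>norm_column_le\<close>).

  The functional obeys the exact relation \<open>\<phi>(z\<^sup>j\<^sup>b p) = \<phi>(P\<^sub>n\<^sup>j p)\<close> for \<open>deg p\<close> below about \<open>b\<close> and
  \<open>j \<le> 2n + 2\<close> (\<open>phi_periodic\<close>). Twice the range of \<open>j\<close> is required because \<open>\<phi>\<close> is applied to
  products of two basis polynomials. By this relation the heavy basis polynomials, those in the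
  windows, are annihilated when paired with each other or with basis polynomials of small degree;
  apart from \<open>\<phi>(1 \<sdot> 1) = 1\<close>, every remaining pair that does not vanish for reasons of degree contains
  a monomial of weight \<open>2\<^sup>-\<^sup>h\<close>, and \<open>h\<close> is chosen so large that this weight outweighs all other factors
  (\<open>phi_bounded\<close>).
\<close>

section \<open>The space of absolutely summable sequences\<close>

lemma norm_coord_le: "norm (coord x n) \<le> norm x"
  unfolding norm_ell1.rep_eq
  using sum_le_suminf[OF summable_norm_coord, of "{n}" x] by simp

lemma coord_sum: "coord (sum f A) n = (\<Sum>i\<in>A. coord (f i) n)"
  by (induction A rule: infinite_finite_induct) (simp_all add: zero_ell1.rep_eq plus_ell1.rep_eq)

lemma bounded_linear_coord: "bounded_linear (\<lambda>x. coord x n)"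
  by (rule bounded_linear_intro[of _ 1])
    (simp_all add: plus_ell1.rep_eq scaleR_ell1.rep_eq norm_coord_le)

lemma norm_ell1_scale: "norm (ell1_scale a x) = norm a * norm x"
  by transfer (simp add: norm_mult suminf_mult)

lemma bounded_linear_ell1_scale: "bounded_linear (ell1_scale a)"
  by (rule bounded_linear_intro[of _ "norm a"])
    (simp_all add: norm_ell1_scale vector_space.vector_space_assms(1)[OF vector_space_ell1_scale] mult.commute,
      transfer, simp)

lemma ell1_scale_of_real: "ell1_scale (of_real r) x = r *\<^sub>R x"
  by transfer (simp add: scaleR_conv_of_real)

lemma norm_le_if_partial_sums_le:
  assumes "\<And>N. (\<Sum>n<N. norm (f n)) \<le> K"
  shows "summable (\<lambda>n. norm (f n))" "norm (Abs_ell1 f) \<le> K"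
proof -
  show *: "summable (\<lambda>n. norm (f n))"
    by (rule summableI_nonneg_bounded[OF _ assms]) simp
  show "norm (Abs_ell1 f) \<le> K"
    unfolding norm_ell1.rep_eq
    using * assms by (simp add: Abs_ell1_inverse suminf_le_const)
qed

instance ell1 :: (banach) banach
proof
  fix X :: "nat \<Rightarrow> 'a ell1"
  assume X: "Cauchy X"
  have "convergent (\<lambda>k. coord (X k) n)" for n
    using bounded_linear.Cauchy[OF bounded_linear_coord X] Cauchy_convergent by blast
  then obtain f where f: "\<And>n. (\<lambda>k. coord (X k) n) \<longlonglongrightarrow> f n"
    unfolding convergent_def by metis
  \<comment> \<open>The tail estimate of a Cauchy sequence passes to the coordinatewise limit one partial sum at a time.\<close>
  have tail: "(\<Sum>n<N. norm (coord (X k) n - f n)) \<le> e"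
    if k: "\<And>l. l \<ge> k \<Longrightarrow> norm (X k - X l) \<le> e" for e k N
  proof (rule tendsto_upperbound)
    show "(\<lambda>l. \<Sum>n<N. norm (coord (X k) n - coord (X l) n)) \<longlonglongrightarrow> (\<Sum>n<N. norm (coord (X k) n - f n))"
      by (intro tendsto_sum tendsto_norm tendsto_diff tendsto_const f)
    have "(\<Sum>n<N. norm (coord (X k) n - coord (X l) n)) \<le> norm (X k - X l)" for l
      unfolding norm_ell1.rep_eq minus_ell1.rep_eq
      using sum_le_suminf[OF summable_norm_coord, of "{..<N}" "X k - X l"]
      by (simp add: minus_ell1.rep_eq)
    then show "\<forall>\<^sub>F l in sequentially. (\<Sum>n<N. norm (coord (X k) n - coord (X l) n)) \<le> e"
      using k by (intro eventually_sequentiallyI[of k]) (meson order_trans)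
  qed simp
  have Cauchy: "\<exists>K. \<forall>k\<ge>K. \<forall>l\<ge>K. norm (X k - X l) < e" if "e > 0" for e
    using X that unfolding Cauchy_def dist_norm by blast
  obtain K where K: "\<And>k l. k \<ge> K \<Longrightarrow> l \<ge> K \<Longrightarrow> norm (X k - X l) < 1"
    using Cauchy[of 1] by auto
  have sum0: "summable (\<lambda>n. norm (coord (X K) n - f n))"
    by (rule norm_le_if_partial_sums_le(1)[OF tail[of K 1]]) (use K in \<open>auto intro: less_imp_le\<close>)
  have "summable (\<lambda>n. norm (coord (X K) n - (coord (X K) n - f n)))"
    by (rule summable_norm_diff[OF summable_norm_coord sum0])
  then have sumf: "summable (\<lambda>n. norm (f n))" by simp
  have "X \<longlonglongrightarrow> Abs_ell1 f"
  proof (rule metric_LIMSEQ_I)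
    fix e :: real assume "e > 0"
    then obtain K where K: "\<And>k l. k \<ge> K \<Longrightarrow> l \<ge> K \<Longrightarrow> norm (X k - X l) < e/2"
      using Cauchy[of "e/2"] by auto
    have "dist (X k) (Abs_ell1 f) < e" if "k \<ge> K" for k
    proof -
      have "X k - Abs_ell1 f = Abs_ell1 (\<lambda>n. coord (X k) n - f n)"
        by (rule ell1_eqI)
          (simp add: minus_ell1.rep_eq Abs_ell1_inverse sumf summable_norm_diff summable_norm_coord)
      moreover have "norm (Abs_ell1 (\<lambda>n. coord (X k) n - f n)) \<le> e/2"
        by (rule norm_le_if_partial_sums_le(2)[OF tail])
          (use K that in \<open>auto intro: less_imp_le\<close>)
      ultimately show ?thesis using \<open>e > 0\<close> by (simp add: dist_norm)
    qed
    then show "\<exists>K. \<forall>k\<ge>K. dist (X k) (Abs_ell1 f) < e" by blast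
  qed
  then show "convergent X" unfolding convergent_def by blast
qed

lift_definition ell1_unit :: "nat \<Rightarrow> 'a::real_normed_field ell1"
  is "\<lambda>i n. if n = i then 1 else 0"
proof -
  fix i
  show "summable (\<lambda>n. norm (if n = i then 1 else 0 :: 'a))"
    by (rule summable_finite[of "{i}"]) auto
qed

lemma norm_sum_ell1_units:
  "norm (\<Sum>i<N. ell1_scale (a i) (ell1_unit i)) = (\<Sum>i<N. norm (a i))"
proof -
  have *: "coord (\<Sum>i<N. ell1_scale (a i) (ell1_unit i)) n = (if n < N then a n else 0)" for n
    by (simp add: coord_sum ell1_scale.rep_eq ell1_unit.rep_eq if_distrib[of "\<lambda>x. _ * x"] sum.delta cong: if_cong)
  show ?thesis
    unfolding norm_ell1.rep_eq *
    by (subst suminf_finite[of "{..<N}"]) auto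
qed

lemma norm_ell1_unit [simp]: "norm (ell1_unit i :: 'a::real_normed_field ell1) = 1"
  unfolding norm_ell1.rep_eq ell1_unit.rep_eq by (subst suminf_finite[of "{i}"]) auto

lemma truncations_tendsto:
  fixes x :: "'a::real_normed_field ell1"
  shows "(\<lambda>N. \<Sum>i<N. ell1_scale (coord x i) (ell1_unit i)) \<longlonglongrightarrow> x"
proof -
  have eq: "norm (x - (\<Sum>i<N. ell1_scale (coord x i) (ell1_unit i))) =
      (\<Sum>n. norm (coord x n)) - (\<Sum>n<N. norm (coord x n))" for N
  proof -
    have *: "coord (x - (\<Sum>i<N. ell1_scale (coord x i) (ell1_unit i))) n = (if n < N then 0 else coord x n)" for n
      by (simp add: minus_ell1.rep_eq coord_sum ell1_scale.rep_eq ell1_unit.rep_eq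
          if_distrib[of "\<lambda>x. _ * x"] sum.delta cong: if_cong)
    show ?thesis
      using suminf_split_initial_segment[OF summable_norm_coord, of x N]
        suminf_split_initial_segment[OF summable_norm_coord, of
          "x - (\<Sum>i<N. ell1_scale (coord x i) (ell1_unit i))" N]
      unfolding norm_ell1.rep_eq by (simp add: *)
  qed
  have "(\<lambda>N. (\<Sum>n. norm (coord x n)) - (\<Sum>n<N. norm (coord x n))) \<longlonglongrightarrow> (\<Sum>n. norm (coord x n)) - (\<Sum>n. norm (coord x n))"
    by (intro tendsto_diff tendsto_const summable_LIMSEQ summable_norm_coord)
  then have "(\<lambda>N. norm (x - (\<Sum>i<N. ell1_scale (coord x i) (ell1_unit i)))) \<longlonglongrightarrow> 0"
    unfolding eq by simp
  then show ?thesis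
    by (subst tendsto_dist_iff) (simp add: dist_norm norm_minus_commute)
qed


definition ell1_operator :: "(nat \<Rightarrow> 'a::{real_normed_field,banach} ell1) \<Rightarrow> 'a ell1 \<Rightarrow> 'a ell1"
  where "ell1_operator t x = (\<Sum>i. ell1_scale (coord x i) (t i))"

context
  fixes t :: "nat \<Rightarrow> 'a::{real_normed_field,banach} ell1" and K :: real
  assumes t: "\<And>i. norm (t i) \<le> K"
begin

lemma summable_ell1_operator_norm: "summable (\<lambda>i. norm (ell1_scale (coord x i) (t i)))"
proof (rule summable_comparison_test'[OF summable_mult2[OF summable_norm_coord[of x], of K], of 0])
  show "norm (norm (ell1_scale (coord x i) (t i))) \<le> norm (coord x i) * K" for i
    by (simp add: norm_ell1_scale mult_left_mono t)
qed

lemma summable_ell1_operator: "summable (\<lambda>i. ell1_scale (coord x i) (t i))"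
  using summable_ell1_operator_norm by (rule summable_norm_cancel)

lemma ell1_operator_add: "ell1_operator t (x + y) = ell1_operator t x + ell1_operator t y"
  unfolding ell1_operator_def plus_ell1.rep_eq
  by (simp add: vector_space.vector_space_assms(2)[OF vector_space_ell1_scale]
      suminf_add summable_ell1_operator)

lemma ell1_operator_scale: "ell1_operator t (ell1_scale a x) = ell1_scale a (ell1_operator t x)"
  unfolding ell1_operator_def
  by (subst bounded_linear.suminf[OF bounded_linear_ell1_scale summable_ell1_operator])
    (simp add: ell1_scale.rep_eq vector_space.vector_space_assms(3)[OF vector_space_ell1_scale])

lemma linear_ell1_operator: "Vector_Spaces.linear ell1_scale ell1_scale (ell1_operator t)"
  unfolding Vector_Spaces.linear_iff
  by (simp add: vector_space_ell1_scale ell1_operator_add ell1_operator_scale)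

lemma bounded_linear_ell1_operator: "bounded_linear (ell1_operator t)"
proof (rule bounded_linear_intro[of _ K])
  show "ell1_operator t (r *\<^sub>R x) = r *\<^sub>R ell1_operator t x" for r x
    using ell1_operator_scale[of "of_real r" x] by (simp add: ell1_scale_of_real)
  have "norm (ell1_operator t x) \<le> (\<Sum>i. norm (coord x i) * K)" for x
    unfolding ell1_operator_def
    by (rule order_trans[OF summable_norm[OF summable_ell1_operator_norm]
          suminf_le[OF _ summable_ell1_operator_norm summable_mult2[OF summable_norm_coord]]])
      (simp add: norm_ell1_scale mult_left_mono t)
  then show "norm (ell1_operator t x) \<le> norm x * K" for x
    by (simp add: norm_ell1.rep_eq suminf_mult2 summable_norm_coord)
qed (rule ell1_operator_add)

lemma ell1_operator_unit: "ell1_operator t (ell1_unit i) = t i"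
  unfolding ell1_operator_def ell1_unit.rep_eq
  by (subst suminf_finite[of "{i}"])
    (auto simp: ell1_eqI ell1_scale.rep_eq zero_ell1.rep_eq)

end

section \<open>Linear extension of a sequence to polynomials\<close>

text \<open>
  The linear map that sends \<open>z\<^sup>l\<close> to \<open>u l\<close>. The scalar multiplication is a parameter because both
  scalar sequences, which give functionals on polynomials, and sequences in \<open>\<ell>\<^sub>1\<close>, which give
  embeddings of the polynomials, occur below.
\<close>

definition poly_comb :: "('a::comm_ring_1 \<Rightarrow> 'b \<Rightarrow> 'b) \<Rightarrow> (nat \<Rightarrow> 'b) \<Rightarrow> 'a poly \<Rightarrow> 'b::ab_group_add"
  where "poly_comb s u p = (\<Sum>l\<le>degree p. s (coeff p l) (u l))"

context module
begin

lemma poly_comb_eq_sum: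
  assumes "\<And>l. coeff p l \<noteq> 0 \<Longrightarrow> l \<in> A" "finite A"
  shows "poly_comb scale u p = (\<Sum>l\<in>A. coeff p l *s u l)"
proof -
  have "poly_comb scale u p = (\<Sum>l\<in>{l. coeff p l \<noteq> 0}. coeff p l *s u l)"
    unfolding poly_comb_def by (rule sum.mono_neutral_right) (auto simp: le_degree)
  also have "\<dots> = (\<Sum>l\<in>A. coeff p l *s u l)"
    by (rule sum.mono_neutral_left) (use assms in auto)
  finally show ?thesis .
qed

lemma poly_comb_le: "degree p \<le> N \<Longrightarrow> poly_comb scale u p = (\<Sum>l\<le>N. coeff p l *s u l)"
  by (rule poly_comb_eq_sum) (auto intro: order_trans[OF le_degree])

lemma poly_comb_add: "poly_comb scale u (p + q) = poly_comb scale u p + poly_comb scale u q"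
proof -
  let ?N = "max (degree p) (degree q)"
  show ?thesis
    by (subst (1 2 3) poly_comb_le[of _ ?N])
      (simp_all add: degree_add_le scale_left_distrib sum.distrib)
qed

lemma poly_comb_smult: "poly_comb scale u (smult a p) = a *s poly_comb scale u p"
  by (subst (1) poly_comb_le[of _ "degree p"])
    (simp_all add: poly_comb_def degree_smult_le scale_sum_right)

lemma poly_comb_0 [simp]: "poly_comb scale u 0 = 0"
  by (simp add: poly_comb_def)

lemma poly_comb_minus: "poly_comb scale u (- p) = - poly_comb scale u p"
  by (simp add: poly_comb_def sum_negf)

lemma poly_comb_diff: "poly_comb scale u (p - q) = poly_comb scale u p - poly_comb scale u q"
  using poly_comb_add[of u p "- q"] by (simp add: poly_comb_minus)

lemma poly_comb_sum: "poly_comb scale u (sum f A) = (\<Sum>i\<in>A. poly_comb scale u (f i))"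
  by (induction A rule: infinite_finite_induct) (simp_all add: poly_comb_add)

lemma poly_comb_monom: "poly_comb scale u (monom a n) = a *s u n"
  by (subst poly_comb_eq_sum[of _ "{n}"]) (auto split: if_splits)

lemma poly_comb_cong: "(\<And>l. l \<le> degree p \<Longrightarrow> u l = w l) \<Longrightarrow> poly_comb scale u p = poly_comb scale w p"
  by (simp add: poly_comb_def)

lemma poly_comb_eq_0: "(\<And>l. l \<le> degree p \<Longrightarrow> u l = 0) \<Longrightarrow> poly_comb scale u p = 0"
  by (simp add: poly_comb_def)

text \<open>
  Both this rule and the next one trade a product for a change of the sequence; they reduce
  statements about \<open>poly_comb\<close> of a product to statements about single indices.
\<close>

lemma poly_comb_mult: "poly_comb scale u (p * q) = poly_comb scale (\<lambda>l. poly_comb scale u (monom 1 l * q)) p"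
proof -
  have "p * q = (\<Sum>l\<le>degree p. smult (coeff p l) (monom 1 l * q))"
    by (subst (1) poly_as_sum_of_monoms[symmetric])
      (simp add: sum_distrib_right smult_monom flip: mult_smult_left)
  then show ?thesis
    by (simp add: poly_comb_sum poly_comb_smult poly_comb_def[of _ _ p])
qed

lemma poly_comb_monom_mult: "poly_comb scale u (monom 1 t * p) = poly_comb scale (\<lambda>l. u (t + l)) p"
  by (subst mult.commute, subst poly_comb_mult, rule poly_comb_cong)
    (simp add: mult_monom poly_comb_monom add.commute)

end

definition coeff_norm :: "'a::real_normed_field poly \<Rightarrow> real"
  where "coeff_norm p = (\<Sum>l\<le>degree p. norm (coeff p l))"

lemma norm_poly_comb_le:
  fixes s :: "'a::real_normed_field \<Rightarrow> 'b::real_normed_vector \<Rightarrow> 'b"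
  assumes "module s" "\<And>a x. norm (s a x) = norm a * norm x"
    and "\<And>l. l \<le> degree p \<Longrightarrow> norm (u l) \<le> K"
  shows "norm (poly_comb s u p) \<le> coeff_norm p * K"
proof -
  interpret module s by fact
  have "norm (poly_comb s u p) \<le> (\<Sum>l\<le>degree p. norm (coeff p l) * K)"
    unfolding poly_comb_def
    by (rule sum_norm_le) (use assms(2,3) in \<open>auto intro: mult_left_mono\<close>)
  then show ?thesis by (simp add: coeff_norm_def sum_distrib_right)
qed

lemma module_ell1_scale: "module (ell1_scale :: 'a::real_normed_field \<Rightarrow> 'a ell1 \<Rightarrow> 'a ell1)"
proof -
  interpret vector_space "ell1_scale :: 'a \<Rightarrow> 'a ell1 \<Rightarrow> 'a ell1" by (rule vector_space_ell1_scale)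
  show ?thesis by (rule module_axioms)
qed

lemma module_times: "module ((*) :: 'a::comm_ring_1 \<Rightarrow> 'a \<Rightarrow> 'a)"
  by unfold_locales (simp_all add: algebra_simps)

abbreviation functional :: "(nat \<Rightarrow> 'a::real_normed_field) \<Rightarrow> 'a poly \<Rightarrow> 'a"
  where "functional \<equiv> poly_comb (*)"

lemmas functional_simps = module.poly_comb_0[OF module_times]
  module.poly_comb_add[OF module_times] module.poly_comb_diff[OF module_times]
  module.poly_comb_smult[OF module_times] module.poly_comb_sum[OF module_times]
  module.poly_comb_monom[OF module_times]

lemma norm_functional_le:
  assumes "\<And>l. l \<le> degree p \<Longrightarrow> norm (u l) \<le> K"
  shows "norm (functional u p) \<le> coeff_norm p * K"
  by (rule norm_poly_comb_le[OF module_times norm_mult assms])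

section \<open>Multiplication by the variable in a triangular basis\<close>

text \<open>
  The vectors \<open>v i\<close> play the role of the monomials \<open>z\<^sup>i\<close> in \<open>\<ell>\<^sub>1\<close>. Their recursion makes the unit vectors
  correspond to the polynomials \<open>c\<^sub>i (z\<^sup>i - R\<^sub>i)\<close>, which form a basis by the triangularity condition
  \<open>R_lower\<close>.
\<close>

locale triangular_basis =
  fixes c :: "nat \<Rightarrow> real" and R :: "nat \<Rightarrow> 'a::{real_normed_field,banach} poly"
  assumes c_pos: "c i > 0"
    and R_lower: "coeff (R i) l \<noteq> 0 \<Longrightarrow> l < i"
begin

definition q :: "nat \<Rightarrow> 'a poly"
  where "q i = monom 1 i - R i"

fun v :: "nat \<Rightarrow> 'a ell1"
  where "v i = (1 / c i) *\<^sub>R ell1_unit i + (\<Sum>l<i. ell1_scale (coeff (R i) l) (v l))"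

declare v.simps [simp del]

abbreviation emb :: "'a poly \<Rightarrow> 'a ell1"
  where "emb \<equiv> poly_comb ell1_scale v"

lemmas emb_simps = module.poly_comb_0[OF module_ell1_scale]
  module.poly_comb_add[OF module_ell1_scale] module.poly_comb_diff[OF module_ell1_scale]
  module.poly_comb_smult[OF module_ell1_scale] module.poly_comb_sum[OF module_ell1_scale]
  module.poly_comb_monom[OF module_ell1_scale] module.scale_one[OF module_ell1_scale]

lemma v_eq: "v i = (1 / c i) *\<^sub>R ell1_unit i + emb (R i)"
  by (subst v.simps, subst module.poly_comb_eq_sum[OF module_ell1_scale, of _ "{..<i}"])
    (use R_lower in auto)

lemma emb_1: "emb 1 = v 0"
  by (simp add: poly_comb_def emb_simps)

lemma emb_q: "emb (q i) = (1 / c i) *\<^sub>R ell1_unit i"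
  by (simp add: q_def emb_simps v_eq)

lemma v_0: "v 0 = (1 / c 0) *\<^sub>R ell1_unit 0"
  by (subst v.simps) simp

lemma q_spans: obtains N a where "p = (\<Sum>i<N. smult (a i) (q i))"
proof -
  have "\<exists>a. p = (\<Sum>i<N. smult (a i) (q i))" if "\<And>l. l \<ge> N \<Longrightarrow> coeff p l = 0" for N p
    using that
  proof (induction N arbitrary: p)
    case 0
    then show ?case by (simp add: poly_eq_iff)
  next
    case (Suc N)
    let ?p = "p - smult (coeff p N) (q N)"
    have "coeff ?p l = 0" if "l \<ge> N" for l
      using that Suc.prems[of l] R_lower[of N l] R_lower[of N N] by (cases "l = N") (auto simp: q_def)
    then obtain a where a: "?p = (\<Sum>i<N. smult (a i) (q i))"
      using Suc.IH by blast
    have "p = (\<Sum>i<Suc N. smult ((a(N := coeff p N)) i) (q i))"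
      using a by (simp add: algebra_simps)
    then show ?case by blast
  qed
  from this[of "Suc (degree p)" p] show ?thesis
    using that by (auto simp: coeff_eq_0 simp del: sum.lessThan_Suc)
qed

lemma emb_sum_q:
  "emb (\<Sum>i<N. smult (a i) (q i)) = (\<Sum>i<N. ell1_scale (a i / of_real (c i)) (ell1_unit i))"
proof -
  have "emb (smult (a i) (q i)) = ell1_scale (a i / of_real (c i)) (ell1_unit i)" for i
    by (simp add: emb_simps emb_q flip: ell1_scale_of_real)
      (simp add: module.scale_scale[OF module_ell1_scale])
  then show ?thesis by (simp add: emb_simps)
qed

lemma emb_dense: "closure (range emb) = UNIV"
proof -
  have "(\<Sum>i<N. ell1_scale (coord x i) (ell1_unit i)) \<in> range emb" for x :: "'a ell1" and N
    using emb_sum_q[of "\<lambda>i. coord x i * of_real (c i)" N] c_pos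
    by (simp add: less_imp_neq[THEN not_sym] range_eqI[OF sym])
  then have "x \<in> closure (range emb)" for x
    unfolding closure_sequential using truncations_tendsto[of x]
    by (intro exI[of _ "\<lambda>N. \<Sum>i<N. ell1_scale (coord x i) (ell1_unit i)"]) blast
  then show ?thesis by blast
qed

text \<open>
  In \<open>\<ell>\<^sub>1\<close> a bilinear form is bounded as soon as it is bounded on pairs of unit vectors.
\<close>

lemma functional_mult_le:
  assumes u: "\<And>i k. c i * c k * norm (functional u (q i * q k)) \<le> 1"
  shows "norm (functional u (p * p')) \<le> norm (emb p) * norm (emb p')"
proof -
  obtain N M a b where p: "p = (\<Sum>i<N. smult (a i) (q i))"
    and p': "p' = (\<Sum>i<M. smult (b i) (q i))"
    using q_spans by metis
  have "functional u (p * p') = (\<Sum>i<N. \<Sum>k<M. a i * b k * functional u (q i * q k))"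
    unfolding p p' sum_product functional_simps mult_smult_left mult_smult_right smult_smult by (simp add: mult_ac)
  then have "norm (functional u (p * p')) = norm (\<Sum>i<N. \<Sum>k<M. a i * b k * functional u (q i * q k))"
    by simp
  also have "\<dots> \<le> (\<Sum>i<N. \<Sum>k<M. norm (a i) * norm (b k) * (1 / (c i * c k)))"
  proof (intro sum_norm_le)
    fix i k
    have "norm (functional u (q i * q k)) \<le> 1 / (c i * c k)"
      using u[of i k] c_pos[of i] c_pos[of k] by (simp add: field_simps)
    then show "norm (a i * b k * functional u (q i * q k)) \<le> norm (a i) * norm (b k) * (1 / (c i * c k))"
      by (simp add: norm_mult mult_left_mono del: times_divide_eq_right)
  qed
  also have "\<dots> = (\<Sum>i<N. norm (a i / of_real (c i))) * (\<Sum>k<M. norm (b k / of_real (c k)))"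
    using c_pos by (simp add: sum_product norm_divide abs_of_pos)
  also have "\<dots> = norm (emb p) * norm (emb p')"
    unfolding p p' by (simp add: emb_sum_q norm_sum_ell1_units)
  finally show ?thesis .
qed

definition column :: "nat \<Rightarrow> 'a ell1"
  where "column i = c i *\<^sub>R emb (monom 1 1 * q i)"

abbreviation T :: "'a ell1 \<Rightarrow> 'a ell1"
  where "T \<equiv> ell1_operator column"

context
  fixes K :: real
  assumes column: "\<And>i. norm (column i) \<le> K"
begin

lemma T_bounded_linear: "bounded_linear T"
  using column by (rule bounded_linear_ell1_operator)

lemma T_unit: "T (ell1_unit i) = column i"
  using column by (rule ell1_operator_unit)

lemma T_scale: "T (ell1_scale a x) = ell1_scale a (T x)"
  using column by (rule ell1_operator_scale)

lemma T_emb: "T (emb p) = emb (monom 1 1 * p)"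
proof -
  interpret T: bounded_linear T by (rule T_bounded_linear)
  obtain N a where p: "p = (\<Sum>i<N. smult (a i) (q i))"
    using q_spans by metis
  have "T (emb (q i)) = emb (monom 1 1 * q i)" for i
    using c_pos[of i] by (simp add: emb_q T.scaleR T_unit column_def)
  then show ?thesis
    unfolding p by (simp add: emb_simps T.sum sum_distrib_left T_scale)
qed

lemma T_pow_emb: "(T ^^ k) (emb p) = emb (monom 1 k * p)"
proof (induction k)
  case (Suc k)
  have "monom 1 1 * (monom 1 k * p) = monom 1 (Suc k) * p"
    unfolding mult.assoc[symmetric] mult_monom by simp
  then show ?case by (simp only: funpow.simps o_apply T_emb Suc)
qed (simp add: monom_0)

lemma T_pow_bounded_linear: "bounded_linear (T ^^ k)"
  by (induction k) (auto simp: id_def o_def intro: bounded_linear_ident bounded_linear_compose[OF T_bounded_linear])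

lemma T_pow_v0: "(T ^^ k) (v 0) = v k"
  using T_pow_emb[of k 1] by (simp add: emb_simps emb_1)

lemma T_pow_v: "(T ^^ l) (v n) = v (n + l)"
  using funpow_add[of l n T] T_pow_v0[of n] T_pow_v0[of "l + n"] by (simp add: add.commute)

text \<open>
  Since the polynomials are dense, their approximation by the orbit of \<open>1\<close> suffices.
\<close>

lemma hypercyclic_T:
  assumes "\<And>p e. e > 0 \<Longrightarrow> \<exists>k. norm (v k - emb p) < e"
  shows "hypercyclic T"
proof -
  have "range emb \<subseteq> closure (range v)"
    using assms by (auto simp: closure_approachable dist_norm)
  then have "closure (range v) = UNIV"
    using emb_dense closure_minimal[OF _ closed_closure] by blast
  then show ?thesis
    unfolding hypercyclic_def by (intro exI[of _ "v 0"]) (simp add: T_pow_v0)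
qed

text \<open>
  Recurrence of the single vector \<open>1\<close> is enough: a nonempty open set contains some polynomial
  \<open>p\<close>, and the bounded operator \<open>p(T)\<close>, called \<open>S\<close> in the proof, maps the recurrence of \<open>1\<close> to
  that of \<open>p\<close>.
\<close>

lemma multiply_recurrent_T:
  assumes "\<And>m e. e > 0 \<Longrightarrow> \<exists>k\<ge>1. \<forall>j\<in>{1..m}. norm (v (k * j) - v 0) < e"
  shows "multiply_recurrent T"
  unfolding multiply_recurrent_def
proof (intro allI impI, elim conjE)
  fix U :: "'a ell1 set" and m :: nat
  assume U: "open U" "U \<noteq> {}"
  then obtain p where p: "emb p \<in> U"
    using emb_dense open_Int_closure_eq_empty[OF U(1), of "range emb"] by blast
  then obtain e where e: "e > 0" "\<And>y. dist y (emb p) < e \<Longrightarrow> y \<in> U"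
    using U unfolding open_dist by blast
  define S where "S x = (\<Sum>l\<le>degree p. ell1_scale (coeff p l) ((T ^^ l) x))" for x
  have S: "bounded_linear S" unfolding S_def
    by (intro bounded_linear_sum bounded_linear_compose[OF bounded_linear_ell1_scale] T_pow_bounded_linear)
  interpret S: bounded_linear S by (rule S)
  obtain B where B: "B > 0" "\<And>x. norm (S x) \<le> norm x * B" using S.pos_bounded by blast
  obtain k where k: "k \<ge> 1" "\<And>j. j \<in> {1..m} \<Longrightarrow> norm (v (k * j) - v 0) < e / B"
    using assms[of "e / B" m] e B by auto
  have Sv: "S (v n) = (T ^^ n) (emb p)" for n
  proof -
    have "S (v n) = (\<Sum>l\<le>degree p. ell1_scale (coeff p l) (v (n + l)))"
      unfolding S_def by (simp add: T_pow_v)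
    then show ?thesis
      unfolding T_pow_emb module.poly_comb_monom_mult[OF module_ell1_scale]
      by (simp add: poly_comb_def)
  qed
  have "(T ^^ (k * j)) (emb p) \<in> U" if "j \<in> {1..m}" for j
  proof (rule e(2))
    have "dist ((T ^^ (k * j)) (emb p)) (emb p) = norm (S (v (k * j) - v 0))"
      using Sv[of 0] by (simp add: dist_norm S.diff Sv)
    also have "\<dots> \<le> norm (v (k * j) - v 0) * B" by (rule B)
    also have "\<dots> < e" using k(2)[OF that] B(1) by (simp add: field_simps)
    finally show "dist ((T ^^ (k * j)) (emb p)) (emb p) < e" .
  qed
  with p k(1) show "\<exists>k\<ge>1. U \<inter> (\<Inter>j\<in>{1..m}. (T ^^ (k * j)) -` U) \<noteq> {}" by blast
qed

lemma approx_orbit_by_emb: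
  assumes "e > 0"
  shows "\<exists>p. norm (emb p - x) < e \<and> norm (emb (monom 1 k * p) - (T ^^ k) x) < e"
proof -
  have "isCont (T ^^ k) x"
    using T_pow_bounded_linear linear_continuous_at by blast
  then obtain d where d: "d > 0" "\<And>y. dist y x < d \<Longrightarrow> dist ((T ^^ k) y) ((T ^^ k) x) < e"
    using assms unfolding continuous_at_eps_delta by blast
  have "x \<in> closure (range emb)" by (simp add: emb_dense)
  then obtain p where "dist (emb p) x < min d e"
    using d(1) assms unfolding closure_approachable by (metis (no_types, lifting) min_less_iff_conj rangeE)
  with d(2)[of "emb p"] show ?thesis by (auto simp: dist_norm T_pow_emb)
qed

text \<open>
  A dense orbit of \<open>T \<oplus> T\<close> visits neighbourhoods of \<open>(0, 1)\<close> and of \<open>(1, 0)\<close>. Whichever visit is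
  earlier, the passage to the later one exchanges \<open>0\<close> and \<open>1\<close> in both coordinates, which contradicts
  \<open>\<phi> ((z\<^sup>k p) p') = \<phi> (p (z\<^sup>k p'))\<close> for the bounded form.
\<close>

lemma not_weakly_mixing_T:
  assumes u: "\<And>i k. c i * c k * norm (functional u (q i * q k)) \<le> 1"
    and u0: "u 0 = 1" and c0: "c 0 = 1"
  shows "\<not> weakly_mixing T"
proof
  have pow: "(map_prod T T ^^ n) (x, y) = ((T ^^ n) x, (T ^^ n) y)" for n x y
    by (induction n) auto
  let ?\<phi> = "functional u"
  note \<phi> = functional_mult_le[OF u]
  have v0: "norm (v 0) = 1" by (simp add: v_0 c0)
  have phi1: "?\<phi> 1 = 1" by (simp add: poly_comb_def u0)
  \<comment> \<open>With all errors below 1/4, the two readings of the product differ from 1 and 0 by at most 9/16 and 1/16.\<close>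
  have no_exchange: False
    if x: "norm x < 1/8" "norm ((T ^^ k) x - v 0) < 1/8"
      and y: "norm (y - v 0) < 1/8" "norm ((T ^^ k) y) < 1/8" for x y k
  proof -
    obtain p where p: "norm (emb p - x) < 1/8" "norm (emb (monom 1 k * p) - (T ^^ k) x) < 1/8"
      using approx_orbit_by_emb[of "1/8" x k] by auto
    obtain p' where p': "norm (emb p' - y) < 1/8" "norm (emb (monom 1 k * p') - (T ^^ k) y) < 1/8"
      using approx_orbit_by_emb[of "1/8" y k] by auto
    let ?z = "monom 1 k"
    have small: "norm (emb p) < 1/4" "norm (emb (?z * p')) < 1/4"
      using norm_triangle_sub[of "emb p" x] norm_triangle_sub[of "emb (?z * p')" "(T ^^ k) y"] p p' x y by linarith+
    have near: "norm (emb (?z * p - 1)) < 1/4" "norm (emb (p' - 1)) < 1/4"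
      using norm_triangle_ineq[of "emb (?z * p) - (T ^^ k) x" "(T ^^ k) x - v 0"]
        norm_triangle_ineq[of "emb p' - y" "y - v 0"] p p' x y
      by (simp_all add: emb_simps emb_1)
    have "norm (emb p') < 5/4"
      using near(2) norm_triangle_sub[of "emb p'" "v 0"] by (simp add: emb_simps emb_1 v0)
    then have 1: "norm (?\<phi> ((?z * p - 1) * p')) \<le> 1/4 * (5/4)"
      using near(1) by (intro order_trans[OF \<phi>] mult_mono) auto
    have 2: "norm (?\<phi> ((p' - 1) * 1)) \<le> 1/4 * 1"
      using near(2) by (intro order_trans[OF \<phi>] mult_mono) (auto simp: emb_1 v0)
    have 3: "norm (?\<phi> (p * (?z * p'))) \<le> 1/4 * (1/4)"
      using small by (intro order_trans[OF \<phi>] mult_mono) auto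
    have "p * (?z * p') = (?z * p - 1) * p' + (p' - 1) * 1 + 1" by (simp add: algebra_simps)
    then have "?\<phi> (p * (?z * p')) - ?\<phi> ((?z * p - 1) * p') - ?\<phi> ((p' - 1) * 1) = 1" (is "?A - ?B - ?C = 1")
      by (simp only: functional_simps phi1) simp
    then have "norm (?A - ?B - ?C) = 1" by (simp only: norm_one)
    then have "1 \<le> norm ?A + norm ?B + norm ?C"
      using norm_triangle_ineq4[of "?A - ?B" ?C] norm_triangle_ineq4[of ?A ?B] by linarith
    with 1 2 3 show False by simp
  qed
  assume "weakly_mixing T"
  then obtain x y where "closure (range (\<lambda>n. (map_prod T T ^^ n) (x, y))) = UNIV"
    unfolding weakly_mixing_def hypercyclic_def by auto
  then have dense: "\<exists>n. norm ((T ^^ n) x - a) < 1/8 \<and> norm ((T ^^ n) y - b) < 1/8" for a b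
  proof -
    assume *: "closure (range (\<lambda>n. (map_prod T T ^^ n) (x, y))) = UNIV"
    have "(a, b) \<in> closure (range (\<lambda>n. (map_prod T T ^^ n) (x, y)))" unfolding * by simp
    then obtain n where n: "dist ((T ^^ n) x, (T ^^ n) y) (a, b) < 1/8"
      unfolding closure_approachable pow by (metis (no_types, lifting) rangeE zero_less_divide_1_iff zero_less_numeral)
    have "dist ((T ^^ n) x) a < 1/8" "dist ((T ^^ n) y) b < 1/8"
      using n dist_fst_le[of "((T ^^ n) x, (T ^^ n) y)" "(a, b)"]
        dist_snd_le[of "((T ^^ n) x, (T ^^ n) y)" "(a, b)"] by simp_all
    then show ?thesis by (auto simp: dist_norm)
  qed
  obtain n m where n: "norm ((T ^^ n) x) < 1/8" "norm ((T ^^ n) y - v 0) < 1/8"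
    and m: "norm ((T ^^ m) x - v 0) < 1/8" "norm ((T ^^ m) y) < 1/8"
    using dense[of 0 "v 0"] dense[of "v 0" 0] by auto
  show False
  proof (cases "n \<le> m")
    case True
    then have "(T ^^ m) w = (T ^^ (m - n)) ((T ^^ n) w)" for w
      using funpow_add[of "m - n" n T] by simp
    with no_exchange[of "(T ^^ n) x" "m - n" "(T ^^ n) y"] n m show False by simp
  next
    case False
    then have "(T ^^ n) w = (T ^^ (n - m)) ((T ^^ m) w)" for w
      using funpow_add[of "n - m" m T] by simp
    with no_exchange[of "(T ^^ m) y" "n - m" "(T ^^ m) x"] n m show False by simp
  qed
qed

end

end

section \<open>Stages, weights and moments\<close>

text \<open>
  The numbers \<open>g n\<close> bound the degrees and, on a logarithmic scale, the coefficients of all powers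
  of \<open>P n\<close> that occur at stage \<open>n\<close>. Measuring every quantity by powers of 2 with natural exponents
  lets a single number, the start of the stage, bound everything that was built before.
\<close>

locale staged_construction =
  fixes P :: "nat \<Rightarrow> 'a::{real_normed_field,banach} poly" and g :: "nat \<Rightarrow> nat"
  assumes degree_P: "j \<le> 2 * Suc n \<Longrightarrow> degree (P n ^ j) \<le> g n"
    and coeff_norm_P: "j \<le> 2 * Suc n \<Longrightarrow> coeff_norm (P n ^ j) \<le> 2 ^ g n"
begin

text \<open>
  Stage \<open>n\<close> occupies the degrees from \<open>start n\<close> up to \<open>start (Suc n)\<close>. Up to \<open>plateau n\<close> the
  monomials have weight 1, then the weight decreases to \<open>2\<^sup>-\<^sup>h\<close> with \<open>h = decay n\<close> and remains there until
  degree \<open>period n\<close>. Windows of length \<open>width n\<close> begin at the multiples of \<open>period n\<close>; the width is the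
  number of halvings that lead from \<open>2\<^sup>n\<close> to \<open>2\<^sup>-\<^sup>h\<close>. The plateau extends beyond the degree of
  \<open>z\<^sup>s P\<^sub>n\<^sup>j\<close> for \<open>s \<le> width n\<close>, so that the norms of these polynomials can be bounded by data
  that are fixed before \<open>decay n\<close>. The value of \<open>decay n\<close> is dictated by
  \<open>phi_light_pair_le\<close>, with some room to spare. The local names in the recursion repeat the definitions that follow it.
\<close>

primrec start :: "nat \<Rightarrow> nat"
  where "start 0 = 1"
  | "start (Suc n) = (let decay = n + 3 * start n + 2 * g n + 2; width = n + decay in
      2 * Suc n * (4 * (width + g n + 1 + decay)) + width)"

definition decay :: "nat \<Rightarrow> nat" where "decay n = n + 3 * start n + 2 * g n + 2"
definition width :: "nat \<Rightarrow> nat" where "width n = n + decay n"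
definition plateau :: "nat \<Rightarrow> nat" where "plateau n = width n + g n + 1"
definition period :: "nat \<Rightarrow> nat" where "period n = 4 * (plateau n + decay n)"

lemmas params = decay_def width_def plateau_def period_def

lemma start_Suc: "start (Suc n) = 2 * Suc n * period n + width n"
  by (simp add: params Let_def)

declare start.simps(2) [simp del]

lemma period_less_start: "2 * period n < start (Suc n)"
proof -
  have "2 * period n \<le> 2 * Suc n * period n" by simp
  moreover have "0 < width n" by (simp add: params)
  ultimately show ?thesis unfolding start_Suc by linarith
qed

lemma start_less_period: "4 * start n < period n"
  by (simp add: params)

lemma start_mono: "m \<le> n \<Longrightarrow> start m \<le> start n"
proof (rule lift_Suc_mono_le[of start])
  show "start n \<le> start (Suc n)" for n using period_less_start[of n] start_less_period[of n] by linarith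
qed

lemma start_ge_1: "1 \<le> start n"
  using start_mono[of 0 n] by simp

text \<open>
  Degree 0 lies below \<open>start 0 = 1\<close>; it is assigned to stage 0, where it is a monomial of weight 1.
  Keeping it out of the interval that begins at \<open>start 0\<close> separates the moment \<open>\<phi>(1) = 1\<close> from the
  moments of stage 0, which vanish below \<open>period 0\<close>.
\<close>

definition in_stage :: "nat \<Rightarrow> nat \<Rightarrow> bool"
  where "in_stage n i \<longleftrightarrow> i < start (Suc n) \<and> (n = 0 \<or> start n \<le> i)"

definition stage :: "nat \<Rightarrow> nat"
  where "stage i = (LEAST n. i < start (Suc n))"

lemma less_start: "n < start n"
proof (induction n)
  case (Suc n)
  then show ?case using period_less_start[of n] start_less_period[of n] by linarith
qed simp

lemma in_stage_stage: "in_stage (stage i) i"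
proof -
  have 1: "i < start (Suc (stage i))"
    unfolding stage_def by (rule LeastI[of _ i]) (use less_start[of "Suc i"] in simp)
  have "start (stage i) \<le> i" if "stage i = Suc n" for n
    using not_less_Least[of n "\<lambda>n. i < start (Suc n)"] that by (simp add: stage_def)
  then show ?thesis using 1 unfolding in_stage_def by (cases "stage i") auto
qed

lemma stage_eq: "in_stage n i \<Longrightarrow> stage i = n"
  using in_stage_stage[of i] start_mono[of "Suc n" "stage i"] start_mono[of "Suc (stage i)" n]
  unfolding in_stage_def by (cases "stage i" n rule: linorder_cases) auto

text \<open>
  The stage ends with the window at the multiple \<open>2n + 2\<close> of the period, hence the restriction on \<open>s\<close>
  in the last block.
\<close>

lemma in_stage_block:
  assumes "1 \<le> j" "j \<le> 2 * Suc n" "s < period n" "j = 2 * Suc n \<longrightarrow> s < width n"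
  shows "in_stage n (j * period n + s)"
proof -
  have "j * period n + s < start (Suc n)"
  proof (cases "j = 2 * Suc n")
    case False
    then have "Suc j * period n \<le> 2 * Suc n * period n" using assms(2) by (intro mult_le_mono1) simp
    with assms(3) show ?thesis by (simp add: start_Suc)
  qed (use assms(4) in \<open>simp add: start_Suc\<close>)
  moreover have "start n \<le> j * period n"
    using start_less_period[of n] mult_le_mono1[OF assms(1), of "period n"] by linarith
  ultimately show ?thesis by (simp add: in_stage_def)
qed

lemma block_cases:
  assumes "i < start (Suc n)" "period n \<le> i"
  obtains j s where "i = j * period n + s" "1 \<le> j" "j \<le> 2 * Suc n" "s < period n" "j = 2 * Suc n \<longrightarrow> s < width n"
proof -
  have period: "0 < period n" "width n < period n" by (simp_all add: params)
  have i: "i = i div period n * period n + i mod period n" by (rule div_mult_mod_eq[symmetric])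
  have "i div period n < Suc (2 * Suc n)"
    using assms(1) period by (subst div_less_iff_less_mult) (auto simp: start_Suc)
  moreover have "1 \<le> i div period n" using assms(2) period by (simp add: Suc_leI div_greater_zero_iff)
  moreover have "i mod period n < width n" if "i div period n = 2 * Suc n"
    using assms(1) i unfolding that start_Suc by linarith
  ultimately show ?thesis using that[OF i] period by simp
qed

definition R :: "nat \<Rightarrow> 'a poly"
  where "R i = (let n = stage i; j = i div period n; s = i mod period n in
    if 1 \<le> j \<and> j \<le> Suc n \<and> s < width n then monom 1 s * P n ^ j else 0)"

text \<open>
  The recursion of the moments: \<open>\<phi>(z\<^sup>i) = \<phi>(moment_poly i)\<close> for \<open>i > 0\<close>. It has the form of \<open>R\<close>, but
  extends over all windows of the stage and not only over the first \<open>n + 1\<close> of them.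
\<close>

definition moment_poly :: "nat \<Rightarrow> 'a poly"
  where "moment_poly i = (let n = stage i; j = i div period n; s = i mod period n in
    if 1 \<le> j \<and> s < width n then monom 1 s * P n ^ j else 0)"

definition c :: "nat \<Rightarrow> real"
  where "c i = (let n = stage i; j = i div period n; s = i mod period n in
    if j = 0 then 1 / 2 ^ min (i - plateau n) (decay n)
    else if j \<le> Suc n then 2 ^ n / 2 ^ min s (width n) else 1 / 2 ^ decay n)"

fun mom :: "nat \<Rightarrow> 'a"
  where "mom i = (if i = 0 then 1 else \<Sum>l<i. coeff (moment_poly i) l * mom l)"

declare mom.simps [simp del]

lemma before_blocks:
  assumes "in_stage n i" "i < period n"
  shows "R i = 0" "moment_poly i = 0" "c i = 1 / 2 ^ min (i - plateau n) (decay n)"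
  using assms by (simp_all add: R_def moment_poly_def c_def stage_eq)

lemma on_blocks:
  assumes "1 \<le> j" "j \<le> 2 * Suc n" "s < period n" "j = 2 * Suc n \<longrightarrow> s < width n"
  shows "R (j * period n + s) = (if j \<le> Suc n \<and> s < width n then monom 1 s * P n ^ j else 0)"
    and "moment_poly (j * period n + s) = (if s < width n then monom 1 s * P n ^ j else 0)"
    and "c (j * period n + s) = (if j \<le> Suc n then 2 ^ n / 2 ^ min s (width n) else 1 / 2 ^ decay n)"
  using assms stage_eq[OF in_stage_block[OF assms]]
  by (auto simp: R_def moment_poly_def c_def Let_def)

lemma coeff_monom_mult_P:
  assumes "coeff (monom 1 s * P n ^ j) l \<noteq> 0" "j \<le> 2 * Suc n"
  shows "l \<le> s + g n"
proof -
  have "l \<le> s + degree (P n ^ j)"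
    using le_degree[of "P n ^ j" "l - s"] assms(1) by (auto simp: coeff_monom_mult split: if_splits)
  with degree_P[OF assms(2)] show ?thesis by linarith
qed

lemma moment_poly_lower: "coeff (moment_poly i) l \<noteq> 0 \<Longrightarrow> l < i"
  and R_lower: "coeff (R i) l \<noteq> 0 \<Longrightarrow> l < i"
proof -
  define n where "n = stage i"
  have in_n: "in_stage n i" using in_stage_stage n_def by simp
  have *: "(coeff (moment_poly i) l \<noteq> 0 \<longrightarrow> l < i) \<and> (coeff (R i) l \<noteq> 0 \<longrightarrow> l < i)"
  proof (cases "i < period n")
    case False
    then obtain j s where js: "i = j * period n + s" "1 \<le> j" "j \<le> 2 * Suc n" "s < period n" "j = 2 * Suc n \<longrightarrow> s < width n"
      using block_cases[of i n] in_n by (auto simp: in_stage_def)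
    have "s + g n < i" if "s < width n"
      using that False by (simp add: params)
    then show ?thesis using coeff_monom_mult_P[of s n j l] js(3)
      unfolding js(1) on_blocks[OF js(2-5)] by (auto split: if_splits)
  qed (simp add: before_blocks[OF in_n])
  show "coeff (moment_poly i) l \<noteq> 0 \<Longrightarrow> l < i" "coeff (R i) l \<noteq> 0 \<Longrightarrow> l < i" using * by auto
qed

sublocale triangular_basis c R
proof
  show "0 < c i" for i by (simp add: c_def Let_def)
qed (rule R_lower)

abbreviation \<phi> :: "'a poly \<Rightarrow> 'a"
  where "\<phi> \<equiv> functional mom"

lemma mom_0: "mom 0 = 1" by (simp add: mom.simps)

lemma mom_eq: "i > 0 \<Longrightarrow> mom i = \<phi> (moment_poly i)"
  by (subst mom.simps, subst module.poly_comb_eq_sum[OF module_times, of _ "{..<i}"])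
    (use moment_poly_lower in auto)

lemma mom_eq_0_in_stage: "in_stage n i \<Longrightarrow> 0 < i \<Longrightarrow> i < period n \<Longrightarrow> mom i = 0"
  by (simp add: mom_eq before_blocks functional_simps)

lemma mom_eq_0_from_start: "start n \<le> i \<Longrightarrow> i < period n \<Longrightarrow> mom i = 0"
  using start_ge_1[of n] period_less_start[of n] by (intro mom_eq_0_in_stage) (auto simp: in_stage_def)

lemma mom_block:
  assumes "1 \<le> j" "j \<le> 2 * Suc n" "s < width n"
  shows "mom (j * period n + s) = \<phi> (monom 1 s * P n ^ j)"
proof -
  have "width n < period n" by (simp add: params)
  with assms show ?thesis by (subst mom_eq) (simp_all add: on_blocks)
qed

text \<open>
  In the last block the degree belongs to the beginning of the next stage.
\<close>

lemma mom_gap: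
  assumes "1 \<le> j" "j \<le> 2 * Suc n" "width n \<le> s" "s < period n"
  shows "mom (j * period n + s) = 0"
proof (cases "j = 2 * Suc n")
  case True
  have "2 * Suc n * period n + period n \<le> 2 * start (Suc n)"
    using period_less_start[of n] by (simp add: start_Suc)
  then show ?thesis
    using assms start_less_period[of "Suc n"] unfolding True by (intro mom_eq_0_from_start[of "Suc n"]) (auto simp: start_Suc)
next
  case False
  then have "moment_poly (j * period n + s) = 0" using on_blocks(2)[of j n s] assms by simp
  with assms(1,3,4) show ?thesis by (subst mom_eq) (simp_all add: functional_simps)
qed

lemma norm_phi_shift_le:
  assumes "\<And>l. l \<le> g n \<Longrightarrow> norm (mom (t + l)) \<le> K" "K \<ge> 0" "j \<le> 2 * Suc n"
  shows "norm (\<phi> (monom 1 t * P n ^ j)) \<le> 2 ^ g n * K"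
proof -
  have "norm (\<phi> (monom 1 t * P n ^ j)) \<le> coeff_norm (P n ^ j) * K"
    unfolding module.poly_comb_monom_mult[OF module_times]
    by (rule norm_functional_le) (use assms degree_P[OF assms(3)] in auto)
  also have "\<dots> \<le> 2 ^ g n * K"
    by (rule mult_right_mono[OF coeff_norm_P[OF assms(3)] assms(2)])
  finally show ?thesis .
qed

text \<open>
  A moment in a window is a combination of moments below the period, with coefficients from a
  power of \<open>P n\<close>. The bound depends only on \<open>g n\<close> and \<open>start n\<close>, and thus on neither the decay nor
  the period of the stage; this is why the decay can be chosen to dominate it.
\<close>

lemma mom_bound_step:
  assumes "\<And>i. i < period n \<Longrightarrow> norm (mom i) \<le> 2 ^ start n" and i: "i < period (Suc n)"
  shows "norm (mom i) \<le> 2 ^ (g n + start n)"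
proof -
  consider "i < period n" | "period n \<le> i" "i < start (Suc n)" | "start (Suc n) \<le> i" by linarith
  then show ?thesis
  proof cases
    case 1
    have "(2::real) ^ start n \<le> 2 ^ (g n + start n)" by (rule power_increasing) auto
    with assms(1)[OF 1] show ?thesis by linarith
  next
    case 2
    then obtain j s where js: "i = j * period n + s" "1 \<le> j" "j \<le> 2 * Suc n" "s < period n"
      using block_cases[of i n] by metis
    have rg: "width n + g n < period n" by (simp add: params)
    show ?thesis
    proof (cases "s < width n")
      case True
      have "norm (\<phi> (monom 1 s * P n ^ j)) \<le> 2 ^ g n * 2 ^ start n"
        by (rule norm_phi_shift_le) (use assms(1) True rg js in auto)
      then show ?thesis using mom_block[OF js(2,3) True] js(1) by (simp add: power_add)
    next
      case False
      then show ?thesis using mom_gap[OF js(2,3) _ js(4)] js(1) by simp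
    qed
  qed (simp add: mom_eq_0_from_start i)
qed

lemma mom_bound: "i < period n \<Longrightarrow> norm (mom i) \<le> 2 ^ start n"
proof (induction n arbitrary: i)
  case 0
  then show ?case
    by (cases "i = 0") (simp_all add: mom_0 mom_eq_0_from_start[of 0])
next
  case (Suc n)
  have "g n + start n \<le> start (Suc n)"
    using period_less_start[of n] by (simp add: params)
  then have "(2::real) ^ (g n + start n) \<le> 2 ^ start (Suc n)" by (rule power_increasing) simp
  moreover have "norm (mom i) \<le> 2 ^ (g n + start n)"
    using Suc by (intro mom_bound_step)
  ultimately show ?case by linarith
qed

text \<open>
  By linearity only monomials \<open>p = z\<^sup>l\<close> matter. Within the window the relation defines the moments;
  beyond it both sides vanish, since the degrees that occur on either side lie in gaps.
\<close>

lemma phi_periodic: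
  assumes "degree p + g n < period n" "j \<le> 2 * Suc n"
  shows "\<phi> (monom 1 (j * period n) * p) = \<phi> (P n ^ j * p)"
proof -
  have "mom (j * period n + l) = \<phi> (monom 1 l * P n ^ j)" if "l \<le> degree p" for l
  proof (cases "j = 0 \<or> l < width n")
    case True
    then show ?thesis
      using assms(2) mom_block[of j n l] by (cases "j = 0") (auto simp: functional_simps)
  next
    case False
    have "\<phi> (monom 1 l * P n ^ j) = 0"
      unfolding module.poly_comb_monom_mult[OF module_times]
    proof (rule module.poly_comb_eq_0[OF module_times], rule mom_eq_0_from_start)
      fix x assume "x \<le> degree (P n ^ j)"
      then show "l + x < period n" using degree_P[OF assms(2)] assms(1) that by linarith
      show "start n \<le> l + x" using False by (simp add: params)
    qed
    moreover have "mom (j * period n + l) = 0"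
      using False assms that by (intro mom_gap) auto
    ultimately show ?thesis by simp
  qed
  then have "poly_comb (*) (\<lambda>l. mom (j * period n + l)) p = poly_comb (*) (\<lambda>l. \<phi> (monom 1 l * P n ^ j)) p"
    by (rule module.poly_comb_cong[OF module_times])
  then show ?thesis
    by (simp only: module.poly_comb_monom_mult[OF module_times, of mom "j * period n"]
        mult.commute[of "P n ^ j"] module.poly_comb_mult[OF module_times, of mom p])
qed

section \<open>Continuity of the operator\<close>

lemma c_le: "in_stage n i \<Longrightarrow> c i \<le> 2 ^ n"
proof -
  assume "in_stage n i"
  then have "stage i = n" by (rule stage_eq)
  have "(1::real) / 2 ^ k \<le> 2 ^ n" "(2::real) ^ n / 2 ^ k \<le> 2 ^ n" for k
    by (simp_all add: field_simps mult_ge1_I)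
  then show ?thesis unfolding c_def Let_def \<open>stage i = n\<close> by auto
qed

text \<open>
  The vectors \<open>v i\<close> below the plateau have norm at most \<open>2 ^ start n\<close>: those of stage \<open>n\<close> are unit
  vectors, and those of earlier stages are estimated by induction.
\<close>

lemma norm_emb_le: "t \<le> width n \<Longrightarrow> j \<le> 2 * Suc n \<Longrightarrow> norm (emb (monom 1 t * P n ^ j)) \<le> 2 ^ (g n + start n)"
proof -
  have emb: "norm (emb (monom 1 t * P n ^ j)) \<le> 2 ^ (g n + start n)"
    if v: "\<And>i. i < plateau n \<Longrightarrow> norm (v i) \<le> 2 ^ start n" and "t \<le> width n" "j \<le> 2 * Suc n" for t j n
  proof -
    have "norm (emb (monom 1 t * P n ^ j)) \<le> coeff_norm (P n ^ j) * 2 ^ start n"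
      unfolding module.poly_comb_monom_mult[OF module_ell1_scale]
      by (rule norm_poly_comb_le[OF module_ell1_scale norm_ell1_scale], rule v)
        (use that degree_P[of j n] in \<open>auto simp: plateau_def\<close>)
    also have "\<dots> \<le> 2 ^ g n * 2 ^ start n"
      by (rule mult_right_mono[OF coeff_norm_P]) (use that in auto)
    finally show ?thesis by (simp add: power_add)
  qed
  have low_v: "norm (v i) = 1" if "in_stage n i" "i < plateau n" for n i
  proof -
    have "i < period n" using that(2) by (simp add: period_def)
    with that show ?thesis by (simp add: v_eq[of i] before_blocks emb_simps)
  qed
  have v: "norm (v i) \<le> 2 ^ start n" if "i < plateau n" for i n
    using that
  proof (induction n arbitrary: i)
    case 0
    moreover have "i < start (Suc 0)" using 0 period_less_start[of 0] by (simp add: period_def)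
    ultimately have "norm (v i) = 1" by (intro low_v[of 0]) (auto simp: in_stage_def)
    then show ?case by simp
  next
    case (Suc n)
    have "decay n + 1 \<le> start (Suc n)" using period_less_start[of n] by (simp add: period_def)
    then have start: "(2::real) ^ (decay n + 1) \<le> 2 ^ start (Suc n)" by (rule power_increasing) simp
    have decay: "(2::real) ^ (g n + start n) \<le> 2 ^ decay n" by (rule power_increasing) (auto simp: decay_def)
    have *: "norm (v i) \<le> 1 / c i + norm (emb (R i))"
      unfolding v_eq[of i] using norm_triangle_ineq[of "(1 / c i) *\<^sub>R ell1_unit i" "emb (R i)"] c_pos[of i]
      by simp
    consider "start (Suc n) \<le> i" | "i < plateau n" | "plateau n \<le> i" "i < period n" | "period n \<le> i" "i < start (Suc n)" by linarith
    then show ?case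
    proof cases
      case 1
      moreover have "i < start (Suc (Suc n))" using Suc.prems period_less_start[of "Suc n"] by (simp add: period_def)
      ultimately have "norm (v i) = 1" using Suc.prems by (intro low_v[of "Suc n"]) (auto simp: in_stage_def)
      then show ?thesis by simp
    next
      case 2
      have "(2::real) ^ start n \<le> 2 ^ start (Suc n)" by (rule power_increasing) (auto intro: start_mono)
      with Suc.IH[OF 2] show ?thesis by linarith
    next
      case 3
      then have "in_stage n i" using period_less_start[of n] by (auto simp: in_stage_def params)
      then have "norm (v i) \<le> 2 ^ min (i - plateau n) (decay n)" using * 3 by (simp add: before_blocks emb_simps)
      also have "\<dots> \<le> 2 ^ (decay n + 1)" by (rule power_increasing) auto
      finally show ?thesis using start by linarith
    next
      case 4
      then obtain j s where js: "i = j * period n + s" "1 \<le> j" "j \<le> 2 * Suc n" "s < period n" "j = 2 * Suc n \<longrightarrow> s < width n"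
        using block_cases by metis
      have "norm (emb (R i)) \<le> 2 ^ (g n + start n)"
        using emb[of n s j] Suc.IH js(3) unfolding js(1) on_blocks[OF js(2-5)] by (auto simp: emb_simps)
      moreover have "1 / c i \<le> 2 ^ decay n"
      proof -
        have "(2::real) ^ min s (width n) \<le> 2 ^ (n + decay n)"
          by (rule power_increasing) (auto simp: width_def)
        then have "(2::real) ^ min s (width n) / 2 ^ n \<le> 2 ^ decay n" by (simp add: field_simps power_add)
        then show ?thesis unfolding js(1) on_blocks[OF js(2-5)] by auto
      qed
      ultimately have "norm (v i) \<le> 2 ^ (decay n + 1)" 
        using * decay power_Suc[of "2::real" "decay n"] unfolding Suc_eq_plus1 by linarith
      with start show ?thesis by linarith
    qed
  qed
  show "t \<le> width n \<Longrightarrow> j \<le> 2 * Suc n \<Longrightarrow> norm (emb (monom 1 t * P n ^ j)) \<le> 2 ^ (g n + start n)"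
    by (rule emb[OF v])
qed

text \<open>
  Multiplication by \<open>z\<close> sends \<open>q\<^sub>i\<close> to \<open>q\<^sub>i\<^sub>+\<^sub>1\<close> plus the defect \<open>D\<close>. The defect is nonzero only where a
  window begins or ends, and there \<open>c\<^sub>i\<close> is at most \<open>2 \<sdot> 2\<^sup>-\<^sup>h\<close>, which absorbs its norm.
\<close>

lemma weight_ratio_and_defect_le:
  fixes i
  defines "D \<equiv> R (Suc i) - monom 1 1 * R i"
  shows "c i \<le> 2 * c (Suc i) \<and> c i * norm (emb D) \<le> 2"
proof -
  define n where "n = stage i"
  have in_n: "in_stage n i" by (simp add: n_def in_stage_stage)
  have small: "(1 / 2 ^ decay n) * norm (emb (monom 1 t * P n ^ j)) \<le> 1" if "t \<le> width n" "j \<le> 2 * Suc n" for t j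
  proof -
    have "(2::real) ^ (g n + start n) \<le> 2 ^ decay n" by (rule power_increasing) (auto simp: decay_def)
    then have "norm (emb (monom 1 t * P n ^ j)) \<le> 2 ^ decay n" using norm_emb_le[OF that] by linarith
    then show ?thesis by (simp add: field_simps)
  qed
  have rb: "width n < period n" "0 < width n" "0 < period n" by (simp_all add: params)
  consider "Suc i < period n" | "Suc i = period n" | "period n \<le> i" using less_linear by linarith
  then show ?thesis
  proof cases
    case 1
    then have Suc: "in_stage n (Suc i)" using in_n period_less_start[of n] by (auto simp: in_stage_def)
    have "(2::real) ^ min (Suc i - plateau n) (decay n) \<le> 2 ^ Suc (min (i - plateau n) (decay n))"
      by (rule power_increasing) auto
    then show ?thesis
      using 1 unfolding D_def before_blocks(1,3)[OF Suc 1] before_blocks(1,3)[OF in_n Suc_lessD[OF 1]]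
      by (simp add: emb_simps field_simps)
  next
    case 2
    \<comment> \<open>The step into the first window.\<close>
    have i: "R i = 0" "c i = 1 / 2 ^ decay n"
      using 2 before_blocks[OF in_n] by (auto simp: period_def min_def)
    have Suc: "R (Suc i) = monom 1 0 * P n ^ 1" "c (Suc i) = 2 ^ n"
      using on_blocks[of 1 n 0] rb 2 by auto
    have "(1::real) / 2 ^ decay n \<le> 2 * 2 ^ n" by (simp add: field_simps mult_ge1_I)
    then have "c i \<le> 2 * c (Suc i)" unfolding i Suc .
    moreover have "c i * norm (emb D) \<le> 1"
      using small[of 0 1] unfolding D_def i Suc by simp
    ultimately show ?thesis by linarith
  next
    case 3
    then obtain j s where js: "i = j * period n + s" "1 \<le> j" "j \<le> 2 * Suc n" "s < period n" "j = 2 * Suc n \<longrightarrow> s < width n"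
      using block_cases in_n in_stage_def by metis
    consider "Suc s < period n" "j = 2 * Suc n \<longrightarrow> Suc s < width n" | "Suc s = period n" | "j = 2 * Suc n" "Suc s = width n"
      using js(4,5) by linarith
    then show ?thesis
    proof cases
      case 1
      have Suc: "Suc i = j * period n + Suc s" using js by simp
      note eqs = on_blocks(1,3)[OF js(2-5), folded js(1)] on_blocks(1,3)[OF js(2,3) 1, folded Suc]
      have "(2::real) ^ min (Suc s) (width n) \<le> 2 ^ Suc (min s (width n))"
        by (rule power_increasing) auto
      then have "(2::real) ^ n / 2 ^ min s (width n) \<le> 2 * (2 ^ n / 2 ^ min (Suc s) (width n))"
        by (simp add: field_simps)
      then have ratio: "c i \<le> 2 * c (Suc i)"
        unfolding eqs by (simp add: divide_right_mono)
      show ?thesis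
      proof (cases "j \<le> Suc n \<and> Suc s = width n")
        case True
        \<comment> \<open>The step out of a window; one halving remains, hence the factor 2.\<close>
        then have D: "D = - (monom 1 (width n) * P n ^ j)"
          unfolding D_def eqs by (simp add: mult_monom flip: mult.assoc)
        have "c i = 2 * (1 / 2 ^ decay n)"
          using True unfolding eqs width_def[of n] by (auto simp: min_def field_simps simp flip: power_add power_Suc)
        then have "c i * norm (emb D) = 2 * ((1 / 2 ^ decay n) * norm (emb (monom 1 (width n) * P n ^ j)))"
          by (simp add: D module.poly_comb_minus[OF module_ell1_scale])
        with ratio small[OF order_refl js(3)] show ?thesis by linarith
      next
        case False
        then have "D = 0"
          unfolding D_def eqs by (auto simp: mult_monom simp flip: mult.assoc)
        with ratio show ?thesis by (simp add: emb_simps)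
      qed
    next
      case 2
      \<comment> \<open>The step to the next multiple of the period.\<close>
      then have Suc: "Suc i = Suc j * period n + 0" and j: "Suc j \<le> 2 * Suc n"
        using js rb by auto
      have eqs: "R i = 0" "c i = 1 / 2 ^ decay n"
        using on_blocks(1,3)[OF js(2-5), folded js(1)] 2 rb by (auto simp: width_def power_add)
      have R: "R (Suc i) = monom 1 0 * P n ^ Suc j \<or> R (Suc i) = 0" and c: "c (Suc i) \<ge> 1 / 2 ^ decay n"
        unfolding Suc using on_blocks(1,3)[of "Suc j" n 0] j rb
        by (auto simp: field_simps mult_ge1_I)
      have "c i * norm (emb D) \<le> 1"
        using R small[of 0 "Suc j"] j eqs by (auto simp: D_def emb_simps)
      moreover have "c i \<le> 2 * c (Suc i)" using c eqs(2) c_pos[of "Suc i"] by linarith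
      ultimately show ?thesis by linarith
    next
      case 3
      \<comment> \<open>The step to the next stage, where the weight returns to 1.\<close>
      then have Suc: "Suc i = start (Suc n)" using js by (simp add: start_Suc)
      have "in_stage (Suc n) (Suc i)"
        unfolding Suc in_stage_def using start_less_period[of "Suc n"] period_less_start[of "Suc n"] by simp
      moreover have "Suc i < period (Suc n)" unfolding Suc using start_less_period[of "Suc n"] by simp
      moreover have "Suc i - plateau (Suc n) = 0" unfolding Suc by (simp add: params)
      ultimately have "R (Suc i) = 0" "c (Suc i) = 1" by (simp_all add: before_blocks)
      moreover have "R i = 0" "c i = 1 / 2 ^ decay n"
        using on_blocks(1,3)[OF js(2-5), folded js(1)] 3 by auto
      moreover have "(1::real) / 2 ^ decay n \<le> 2"
        by (rule order_trans[of _ 1]) (simp_all add: divide_le_eq)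
      ultimately show ?thesis by (simp add: D_def emb_simps)
    qed
  qed
qed

lemma norm_column_le: "norm (column i) \<le> 4"
proof -
  have "monom 1 1 * q i = monom 1 (Suc i) - monom 1 1 * R i"
    by (simp add: q_def right_diff_distrib mult_monom)
  then have eq: "emb (monom 1 1 * q i) = (1 / c (Suc i)) *\<^sub>R ell1_unit (Suc i) + emb (R (Suc i) - monom 1 1 * R i)"
    by (simp add: emb_simps v_eq[of "Suc i"])
  have "norm (column i) \<le> c i / c (Suc i) + c i * norm (emb (R (Suc i) - monom 1 1 * R i))"
    unfolding column_def eq scaleR_add_right using c_pos[of i] c_pos[of "Suc i"]
    by (intro order_trans[OF norm_triangle_ineq]) simp
  moreover have "c i / c (Suc i) \<le> 2"
    using weight_ratio_and_defect_le[of i] c_pos[of "Suc i"] by (simp add: field_simps)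
  ultimately show ?thesis using weight_ratio_and_defect_le[of i] by linarith
qed

section \<open>Boundedness of the bilinear form\<close>

lemma R_cases:
  assumes "in_stage n i"
  shows "R i = 0 \<or> (\<exists>s j. s < width n \<and> j \<le> Suc n \<and> R i = monom 1 s * P n ^ j)"
  unfolding R_def Let_def stage_eq[OF assms] by auto

text \<open>
  A crude estimate that ignores all cancellation. Its right-hand side is independent of \<open>decay n\<close>.
\<close>

lemma c_phi_monom_q_le:
  assumes i: "i < start (Suc n)" and k: "k < start (Suc n)"
  shows "c i * norm (\<phi> (monom 1 k * q i)) \<le> 2 ^ (n + g n + 1 + start n) * 2 ^ (g n + start n)"
proof -
  define m where "m = stage i"
  define G :: real where "G = 2 ^ (g n + start n)"
  have in_m: "in_stage m i" by (simp add: m_def in_stage_stage)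
  have G: "norm (mom t) \<le> G" if "t < period (Suc n)" for t
    unfolding G_def using mom_bound that by (rule mom_bound_step)
  have mn: "m \<le> n"
  proof (rule ccontr)
    assume "\<not> m \<le> n"
    then have "start (Suc n) \<le> start m" "m \<noteq> 0" by (auto intro: start_mono)
    then show False using i in_m by (simp add: in_stage_def)
  qed
  have rg: "width m + g m < start (Suc n)"
    using period_less_start[of m] start_mono[of "Suc m" "Suc n"] mn by (simp add: params)
  have "norm (\<phi> (monom 1 k * R i)) \<le> 2 ^ g m * G"
  proof (cases "R i = 0")
    case False
    then obtain s j where sj: "s < width m" "j \<le> Suc m" "R i = monom 1 s * P m ^ j"
      using R_cases[OF in_m] by blast
    then have eq: "monom 1 k * R i = monom 1 (k + s) * P m ^ j"
      by (simp add: mult_monom flip: mult.assoc)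
    show ?thesis
      unfolding eq by (rule norm_phi_shift_le)
        (use k rg sj start_less_period[of "Suc n"] in \<open>auto intro!: G[unfolded G_def] simp: G_def\<close>)
  qed (simp add: functional_simps G_def)
  moreover have "norm (mom (k + i)) \<le> G"
    using i k start_less_period[of "Suc n"] by (intro G) linarith
  moreover have "\<phi> (monom 1 k * q i) = mom (k + i) - \<phi> (monom 1 k * R i)"
    by (simp add: q_def right_diff_distrib mult_monom functional_simps)
  ultimately have "norm (\<phi> (monom 1 k * q i)) \<le> G + 2 ^ g m * G"
    using norm_triangle_ineq4[of "mom (k + i)" "\<phi> (monom 1 k * R i)"] by simp
  also have "\<dots> \<le> 2 ^ (g m + 1) * G"
    using mult_right_mono[of 1 "2 ^ g m" G] by (simp add: G_def)
  finally have "c i * norm (\<phi> (monom 1 k * q i)) \<le> 2 ^ m * (2 ^ (g m + 1) * G)"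
    using c_le[OF in_m] c_pos[of i] by (intro mult_mono) auto
  also have "\<dots> = 2 ^ (m + g m + 1) * G" by (simp add: power_add)
  also have "\<dots> \<le> 2 ^ (n + g n + 1 + start n) * G"
  proof (intro mult_right_mono power_increasing)
    have "m + g m + 1 \<le> start (Suc m)" using period_less_start[of m] by (simp add: params)
    then show "m + g m + 1 \<le> n + g n + 1 + start n"
      using mn start_mono[of "Suc m" n] by (cases "m = n") auto
  qed (simp_all add: G_def)
  finally show ?thesis unfolding G_def .
qed

text \<open>
  One light factor compensates the crude estimate, since its exponents add up to at most
  \<open>decay n\<close>.
\<close>

lemma phi_light_pair_le:
  assumes "R k = 0" "c k = 1 / 2 ^ decay n" "k < start (Suc n)" "i < start (Suc n)"
  shows "c i * c k * norm (\<phi> (q i * q k)) \<le> 1"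
proof -
  have "c i * norm (\<phi> (q i * q k)) \<le> 2 ^ (n + g n + 1 + start n) * 2 ^ (g n + start n)"
    using c_phi_monom_q_le[OF assms(4,3)] assms(1) by (simp add: q_def[of k] mult.commute)
  also have "\<dots> \<le> (2::real) ^ decay n"
    unfolding power_add[symmetric] by (rule power_increasing) (auto simp: decay_def)
  finally have "c i * norm (\<phi> (q i * q k)) / 2 ^ decay n \<le> 1" by (simp add: divide_le_eq)
  then show ?thesis by (simp add: assms(2))
qed

lemma degree_q_le: "degree (q i) \<le> i"
  by (rule degree_le) (use R_lower in \<open>auto simp: q_def\<close>, fastforce)

text \<open>
  A basis polynomial up to stage \<open>n\<close> has small degree, or is a monomial of the least weight \<open>2\<^sup>-\<^sup>h\<close>, or
  lies in one of the windows of stage \<open>n\<close>.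
\<close>

lemma index_cases:
  assumes "i < start (Suc n)"
  obtains (early) "2 * i < period n"
  | (light) "R i = 0" "c i = 1 / 2 ^ decay n"
  | (heavy) j s where "1 \<le> j" "j \<le> Suc n" "s < width n" "i = j * period n + s"
proof -
  consider "2 * i < period n" | "period n \<le> 2 * i" "i < period n" | "period n \<le> i" by linarith
  then show ?thesis
  proof cases
    case 2
    then have "in_stage n i" "decay n \<le> i - plateau n" using assms by (auto simp: in_stage_def params)
    then show ?thesis using before_blocks[of n i] 2 by (intro light) auto
  next
    case 3
    then obtain j s where js: "i = j * period n + s" "1 \<le> j" "j \<le> 2 * Suc n" "s < period n" "j = 2 * Suc n \<longrightarrow> s < width n"
      using block_cases assms by metis
    show ?thesis
    proof (cases "j \<le> Suc n \<and> s < width n")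
      case False
      then have "R i = 0" "c i = 1 / 2 ^ decay n"
        using on_blocks(1,3)[OF js(2-5), folded js(1)] by (auto simp: width_def power_add min_def)
      then show ?thesis by (rule light)
    qed (use js heavy in blast)
  qed (rule early)
qed

lemma q_heavy:
  assumes "1 \<le> j" "j \<le> Suc n" "s < width n"
  shows "q (j * period n + s) = monom 1 s * (monom 1 (j * period n) - P n ^ j)"
proof -
  have "s < period n" using assms by (simp add: params)
  then show ?thesis
    using on_blocks(1)[of j n s] assms by (simp add: q_def right_diff_distrib mult_monom add.commute)
qed

text \<open>
  Expanding the product gives four terms, and \<open>phi_periodic\<close> turns each of them into
  \<open>\<plusminus>\<phi>(z\<^sup>s\<^sup>+\<^sup>t P\<^sub>n\<^sup>l\<^sup>+\<^sup>j)\<close>. The term with \<open>z\<close> to the power \<open>(l + j) b\<close> is the reason for prescribing moments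
  at \<open>2n + 2\<close> multiples of the period.
\<close>

lemma phi_heavy_pair_eq_0:
  assumes i: "l \<le> Suc n" "t < width n" and k: "j \<le> Suc n" "s < width n"
  shows "\<phi> (monom 1 t * (monom 1 (l * period n) - P n ^ l) * (monom 1 s * (monom 1 (j * period n) - P n ^ j))) = 0"
proof -
  let ?w = "monom 1 (s + t) :: 'a poly"
  have deg: "degree (?w * P n ^ x) + g n < period n" if "x \<le> Suc n" for x
  proof -
    have "degree (P n ^ x) \<le> g n" using that by (intro degree_P) simp
    then have "degree (?w * P n ^ x) \<le> s + t + g n"
      using degree_mult_le[of ?w "P n ^ x"] degree_monom_le[of "1::'a" "s + t"]
      by linarith
    then show ?thesis using i k by (simp add: params)
  qed
  have "\<phi> (monom 1 ((l + j) * period n) * ?w) = \<phi> (P n ^ (l + j) * ?w)"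
    using deg[of 0] i k by (intro phi_periodic) auto
  moreover have "\<phi> (monom 1 (l * period n) * (?w * P n ^ j)) = \<phi> (P n ^ l * (?w * P n ^ j))"
    using deg[of j] i k by (intro phi_periodic) auto
  moreover have "\<phi> (monom 1 (j * period n) * (?w * P n ^ l)) = \<phi> (P n ^ j * (?w * P n ^ l))"
    using deg[of l] i k by (intro phi_periodic) auto
  moreover have "monom 1 t * (monom 1 (l * period n) - P n ^ l) * (monom 1 s * (monom 1 (j * period n) - P n ^ j)) =
      monom 1 ((l + j) * period n) * ?w - monom 1 (l * period n) * (?w * P n ^ j) - monom 1 (j * period n) * (?w * P n ^ l)
      + P n ^ (l + j) * ?w"
  proof -
    have "monom 1 (s + t) = monom 1 s * (monom 1 t :: 'a poly)"
      "monom 1 ((l + j) * period n) = monom 1 (l * period n) * (monom 1 (j * period n) :: 'a poly)"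
      by (simp_all add: mult_monom add_mult_distrib)
    then show ?thesis by (simp only: power_add) (simp add: algebra_simps)
  qed
  ultimately show ?thesis
    by (simp only: functional_simps) (simp add: power_add mult_ac)
qed

text \<open>
  Let \<open>n\<close> be the stage of the larger degree \<open>k\<close>. If \<open>k > 0\<close> is early, the product lives in degrees between
  \<open>start n\<close> and \<open>period n\<close>, where the moments vanish. A light factor is covered by
  \<open>phi_light_pair_le\<close>. If \<open>k\<close> is heavy, the form vanishes by periodicity both for early and for heavy
  \<open>i\<close>.
\<close>

lemma phi_bounded_ordered:
  assumes "i \<le> k"
  shows "c i * c k * norm (\<phi> (q i * q k)) \<le> 1"
proof (cases "k = 0")
  case True
  have "R 0 = 0" "c 0 = 1"
    using before_blocks[of 0 0] start_less_period[of 0] period_less_start[of 0] by (auto simp: in_stage_def)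
  then have "q 0 = 1" by (simp add: q_def)
  with True assms \<open>c 0 = 1\<close> show ?thesis by (simp add: poly_comb_def mom_0)
next
  case False
  define n where "n = stage k"
  have in_n: "in_stage n k" by (simp add: n_def in_stage_stage)
  then have k: "k < start (Suc n)" "start n \<le> k" using False by (auto simp: in_stage_def)
  then have i: "i < start (Suc n)" using assms by simp
  from k(1) show ?thesis
  proof (cases k rule: index_cases)
    case early
    have "\<phi> (monom 1 k * q i) = 0"
      unfolding module.poly_comb_monom_mult[OF module_times]
    proof (rule module.poly_comb_eq_0[OF module_times], rule mom_eq_0_from_start)
      fix l assume "l \<le> degree (q i)"
      then show "k + l < period n" using degree_q_le[of i] assms early by linarith
      show "start n \<le> k + l" using k by simp
    qed
    moreover have "q k = monom 1 k" using before_blocks[OF in_n] early by (simp add: q_def)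
    ultimately show ?thesis by (simp add: mult.commute)
  next
    case light
    then show ?thesis using phi_light_pair_le k(1) i by blast
  next
    case (heavy j s)
    note q_k = q_heavy[OF heavy(1-3), folded heavy(4)]
    from i show ?thesis
    proof (cases i rule: index_cases)
      case early
      have "degree (monom 1 s * q i) + g n < period n"
        using degree_mult_le[of "monom 1 s" "q i"] degree_monom_le[of "1::'a" s] degree_q_le[of i] early heavy
        by (simp add: params)
      then have "\<phi> (monom 1 (j * period n) * (monom 1 s * q i)) = \<phi> (P n ^ j * (monom 1 s * q i))"
        using heavy by (intro phi_periodic) auto
      moreover have "q i * q k = monom 1 (j * period n) * (monom 1 s * q i) - P n ^ j * (monom 1 s * q i)"
        unfolding q_k by (simp add: algebra_simps)
      ultimately show ?thesis by (simp add: functional_simps)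
    next
      case light
      then show ?thesis using phi_light_pair_le[OF light i k(1)] by (simp add: mult_ac)
    next
      case (heavy l t)
      then show ?thesis
        using phi_heavy_pair_eq_0[of l n t j s] q_heavy[OF heavy(1-3)] q_k \<open>j \<le> Suc n\<close> \<open>s < width n\<close> by simp
    qed
  qed
qed

lemma phi_bounded: "c i * c k * norm (\<phi> (q i * q k)) \<le> 1"
  using phi_bounded_ordered[of i k] phi_bounded_ordered[of k i]
  by (cases "i \<le> k") (simp_all add: mult_ac)

lemma norm_v_minus_emb:
  assumes "1 \<le> j" "j \<le> Suc n"
  shows "norm (v (j * period n) - emb (P n ^ j)) = 1 / 2 ^ n"
proof -
  have "0 < width n" "0 < period n" by (simp_all add: params)
  then have "R (j * period n) = P n ^ j" "c (j * period n) = 2 ^ n"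
    using on_blocks(1,3)[of j n 0] assms by auto
  then show ?thesis by (simp add: v_eq[of "j * period n"])
qed

lemma period_pos: "1 \<le> period n"
  by (simp add: params)

end

section \<open>Existence of the operator\<close>

lemma countable_polys_over:
  assumes "countable D"
  shows "countable {p :: 'a::zero poly. \<forall>l. coeff p l \<in> D}"
proof -
  have "{p. \<forall>l. coeff p l \<in> D} \<subseteq> Poly ` lists D"
  proof
    fix p :: "'a poly" assume "p \<in> {p. \<forall>l. coeff p l \<in> D}"
    then have "set (coeffs p) \<subseteq> D" by (auto simp: coeffs_def)
    then have "coeffs p \<in> lists D" by auto
    then show "p \<in> Poly ` lists D" by (metis Poly_coeffs imageI)
  qed
  then show ?thesis by (meson assms countable_image countable_lists countable_subset)
qed

lemma poly_enumeration:
  obtains P :: "nat \<Rightarrow> 'a::{real_normed_field,second_countable_topology} poly"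
  where "\<And>p d N. d > 0 \<Longrightarrow> \<exists>n\<ge>N. degree (P n) \<le> degree p \<and> (\<forall>l. norm (coeff (P n) l - coeff p l) < d)"
    and "\<And>N. \<exists>n\<ge>N. P n = 1"
proof -
  obtain D :: "'a set" where D: "countable D" "\<And>X. open X \<Longrightarrow> X \<noteq> {} \<Longrightarrow> \<exists>d\<in>D. d \<in> X"
    using countable_dense_exists by blast
  \<comment> \<open>0 is adjoined to allow finitely supported coefficient sequences, 1 to make the constant 1 available.\<close>
  define S where "S = {p. \<forall>l. coeff p l \<in> insert 0 (insert 1 D)}"
  \<comment> \<open>The second component of the pair is ignored, so every element is repeated infinitely often.\<close>
  define P where "P n = from_nat_into S (fst (prod_decode n))" for n
  have 1: "1 \<in> S" by (auto simp: S_def)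
  have "countable S" unfolding S_def using D(1) by (intro countable_polys_over) auto
  then have inf: "\<exists>n\<ge>N. P n = p" if "p \<in> S" for p N
  proof -
    let ?n = "prod_encode (to_nat_on S p, N)"
    have "P ?n = p" using \<open>countable S\<close> that by (simp add: P_def)
    moreover have "N \<le> ?n" by (rule le_prod_encode_2)
    ultimately show ?thesis by blast
  qed
  show ?thesis
  proof (rule that)
    show "\<exists>n\<ge>N. P n = 1" for N using inf[OF 1] .
    fix p :: "'a poly" and d :: real and N :: nat
    assume d: "d > 0"
    have "\<exists>x\<in>D. norm (x - coeff p l) < d" for l
      using D(2)[of "ball (coeff p l) d"] d by (auto simp: dist_norm norm_minus_commute)
    then obtain f where f: "\<And>l. f l \<in> D" "\<And>l. norm (f l - coeff p l) < d" by metis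
    define p' where "p' = (\<Sum>l\<le>degree p. monom (f l) l)"
    have coeff: "coeff p' l = (if l \<le> degree p then f l else 0)" for l
      by (simp add: p'_def coeff_sum if_distrib[of "\<lambda>x. x _"] cong: if_cong)
    have "p' \<in> S" using f(1) by (simp add: S_def coeff)
    moreover have "degree p' \<le> degree p" by (rule degree_le) (simp add: coeff)
    moreover have "norm (coeff p' l - coeff p l) < d" for l
      using f(2) d by (simp add: coeff coeff_eq_0)
    ultimately show "\<exists>n\<ge>N. degree (P n) \<le> degree p \<and> (\<forall>l. norm (coeff (P n) l - coeff p l) < d)"
      using inf by metis
  qed
qed

theorem exists_hypercyclic_multiply_recurrent_not_weakly_mixing:
  "\<exists>T :: 'a::{real_normed_field,banach,second_countable_topology} ell1 \<Rightarrow> 'a ell1.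
      Vector_Spaces.linear ell1_scale ell1_scale T \<and> continuous_on UNIV T \<and>
      multiply_recurrent T \<and> hypercyclic T \<and> \<not> weakly_mixing T"
proof -
  obtain P :: "nat \<Rightarrow> 'a poly" where
    dense: "\<And>p d N. d > 0 \<Longrightarrow> \<exists>n\<ge>N. degree (P n) \<le> degree p \<and> (\<forall>l. norm (coeff (P n) l - coeff p l) < d)"
    and P_1: "\<And>N. \<exists>n\<ge>N. P n = 1"
    by (rule poly_enumeration) blast
  \<comment> \<open>A sum serves as a common upper bound of finitely many numbers.\<close>
  define g where "g n = (\<Sum>j\<le>2 * Suc n. degree (P n ^ j) + nat \<lceil>coeff_norm (P n ^ j)\<rceil>)" for n
  have g: "degree (P n ^ j) + nat \<lceil>coeff_norm (P n ^ j)\<rceil> \<le> g n" if "j \<le> 2 * Suc n" for n j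
    unfolding g_def using that
    by (intro member_le_sum[of j _ "\<lambda>j. degree (P n ^ j) + nat \<lceil>coeff_norm (P n ^ j)\<rceil>"]) auto
  interpret staged_construction P g
  proof
    fix n j assume "j \<le> 2 * Suc n"
    note g = g[OF this]
    then show "degree (P n ^ j) \<le> g n" by simp
    have "coeff_norm (P n ^ j) \<le> real (nat \<lceil>coeff_norm (P n ^ j)\<rceil>)" by (rule real_nat_ceiling_ge)
    also have "\<dots> \<le> real (g n)" by (rule of_nat_mono) (use g in linarith)
    also have "\<dots> \<le> 2 ^ g n" using of_nat_less_two_power[of "g n"] by (simp add: less_imp_le)
    finally show "coeff_norm (P n ^ j) \<le> 2 ^ g n" .
  qed
  have small: "\<exists>N. \<forall>n\<ge>N. 1 / 2 ^ n < e" if e: "e > 0" for e :: real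
  proof -
    obtain N where N: "(1 / 2) ^ N < e" using real_arch_pow_inv[OF e, of "1/2"] by auto
    have "1 / 2 ^ n < e" if "n \<ge> N" for n
      using power_decreasing[OF that, of "1/2::real"] N by (simp add: power_one_over)
    then show ?thesis by blast
  qed
  have "hypercyclic T"
  proof (rule hypercyclic_T[OF norm_column_le])
    fix p :: "'a poly" and e :: real assume e: "e > 0"
    define K where "K = 1 + (\<Sum>l\<le>degree p. norm (v l))"
    have K: "K > 0" unfolding K_def by (intro add_pos_nonneg sum_nonneg) auto
    obtain N where N: "\<And>n. n \<ge> N \<Longrightarrow> 1 / 2 ^ n < e / 2" using small[of "e / 2"] e by auto
    have "e / (2 * K) > 0" using e K by simp
    then obtain n where n: "n \<ge> N" "degree (P n) \<le> degree p" "\<And>l. norm (coeff (P n) l - coeff p l) < e / (2 * K)"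
      using dense by metis
    have diff: "emb (P n) - emb p = (\<Sum>l\<le>degree p. ell1_scale (coeff (P n - p) l) (v l))"
      using module.poly_comb_le[OF module_ell1_scale, of "P n - p" "degree p" v] n(2)
      by (simp add: emb_simps degree_diff_le)
    have "norm (emb (P n) - emb p) \<le> (\<Sum>l\<le>degree p. e / (2 * K) * norm (v l))"
      unfolding diff coeff_diff
      by (rule sum_norm_le, unfold norm_ell1_scale)
        (rule mult_right_mono[OF less_imp_le[OF n(3)] norm_ge_zero])
    also have "\<dots> = e / (2 * K) * (K - 1)" by (simp add: K_def sum_distrib_left)
    also have "\<dots> \<le> e / 2" using K e by (simp add: field_simps)
    finally have "norm (emb (P n) - emb p) \<le> e / 2" .
    moreover have "norm (v (period n) - emb (P n)) < e / 2"
      using norm_v_minus_emb[of 1 n] N[OF n(1)] by simp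
    ultimately have "norm (v (period n) - emb p) < e"
      using norm_triangle_ineq[of "v (period n) - emb (P n)" "emb (P n) - emb p"] by simp
    then show "\<exists>k. norm (v k - emb p) < e" by blast
  qed
  moreover have "multiply_recurrent T"
  proof (rule multiply_recurrent_T[OF norm_column_le])
    fix m :: nat and e :: real assume "e > 0"
    then obtain N where N: "\<And>n. n \<ge> N \<Longrightarrow> 1 / 2 ^ n < e" using small by blast
    obtain n where n: "n \<ge> max N m" "P n = 1" using P_1 by blast
    have "norm (v (period n * j) - v 0) < e" if "j \<in> {1..m}" for j
      using norm_v_minus_emb[of j n] N[of n] n that by (simp add: emb_1 mult.commute)
    then show "\<exists>k\<ge>1. \<forall>j\<in>{1..m}. norm (v (k * j) - v 0) < e" using period_pos by blast
  qed
  moreover have "\<not> weakly_mixing T"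
  proof (rule not_weakly_mixing_T[OF norm_column_le phi_bounded mom_0])
    show "c 0 = 1"
      using before_blocks[of 0 0] start_less_period[of 0] period_less_start[of 0] by (auto simp: in_stage_def)
  qed
  moreover have "continuous_on UNIV T"
    by (rule linear_continuous_on[OF T_bounded_linear[OF norm_column_le]])
  moreover have "Vector_Spaces.linear ell1_scale ell1_scale T"
    by (rule linear_ell1_operator[OF norm_column_le])
  ultimately show ?thesis by (intro exI[of _ T] conjI)
qed

theorem theorem4p1:
  "(\<exists>T :: real ell1 \<Rightarrow> real ell1.
      Vector_Spaces.linear ell1_scale ell1_scale T \<and> continuous_on UNIV T \<and>
      multiply_recurrent T \<and> hypercyclic T \<and> \<not> weakly_mixing T) \<and>
   (\<exists>T :: complex ell1 \<Rightarrow> complex ell1.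
      Vector_Spaces.linear ell1_scale ell1_scale T \<and> continuous_on UNIV T \<and>
      multiply_recurrent T \<and> hypercyclic T \<and> \<not> weakly_mixing T)"
  by (intro conjI exists_hypercyclic_multiply_recurrent_not_weakly_mixing)

end
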